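(* For every $\epsilon>0$ there exists a probabilistic algorithm $(L,F)$ such that, with $L$-probability at least $1-\epsilon$, the output $F(\alpha)$ is an infinite binary sequence $\omega=\omega_1\omega_2\dots$ with the following property: for every partial deterministic forecasting algorithm $f$ defined on all initial fragments $\omega^0,\omega^1,\dots$ of $\omega$, there exists a computable outcome-based selection rule $\delta$ defined on all these fragments such that $$\limsup_{n\to\infty}\left|\frac{1}{n}\sum_{i=1}^{n}\delta(\omega^{i-1})\,(\omega_i-f(\omega^{i-1}))\right|\ge \frac18 .$$
   Context: $\Omega$ is the set of infinite binary sequences, $\Xi$ the set of finite binary sequences, $\lambda$ the empty sequence; $\omega^n=\omega_1\dots\omega_n$ ($\omega^0=\lambda$); $x\sqsubseteq\omega$ means $x$ is a prefix of $\omega$; $\Gamma_x=\{\omega\in\Omega:x\sqsubseteq\omega\}$. $L$ is the uniform measure on $\Omega$, $L(\Gamma_x)=2^{-l(x)}$. A computable operation $F$ is given by a recursively enumerable set $\hat F\subseteq\Xi\times\Xi$ such that (i) $(x,\lambda)\in\hat F$ for all $x$, and (ii) if $(x,y),(x',y')\in\hat F$ and $x\sqsubseteq x'$ then $y\sqsubseteq y'$ or $y'\sqsubseteq y$; then $F(\omega)=\sup\{y:x\sqsubseteq\omega,\ (x,y)\in\hat F\}$ (supremum in the prefix order). A probabilistic algorithm is a pair $(L,F)$ with $F$ a computable operation; the probability of outputting a sequence in $A$ is $L\{\alpha:F(\alpha)\in A\}$. A partial deterministic forecasting algorithm is a partial recursive real function $f:\Xi\to[0,1]$, i.e. there is an algorithm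 which on input $x$ and rational $\kappa>0$ either outputs a rational within $\kappa$ of $f(x)$ or does not halt, with $f(x)$ defined iff it halts for every $\kappa$. An outcome-based selection rule is a function $\delta:\Xi\to\{0,1\}$; it is computable if it is partial recursive. *)

theory Defs
  imports "HOL-Probability.Probability" "HOL-Library.Nat_Bijection"
begin

datatype recf = Zero | Succ | Proj nat | Comp recf "recf list"
  | PrimRec recf recf | Mu recf

inductive eval :: "recf \<Rightarrow> nat list \<Rightarrow> nat \<Rightarrow> bool" where
  eval_Zero: "eval Zero xs 0"
| eval_Succ: "eval Succ (x # xs) (Suc x)"
| eval_Proj: "i < length xs \<Longrightarrow> eval (Proj i) xs (xs ! i)"
| eval_Comp: "list_all2 (\<lambda>g y. eval g xs y) gs ys \<Longrightarrow> eval f ys z \<Longrightarrow> eval (Comp f gs) xs z"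
| eval_Prim0: "eval g xs y \<Longrightarrow> eval (PrimRec g h) (0 # xs) y"
| eval_PrimS: "eval (PrimRec g h) (n # xs) y \<Longrightarrow> eval h (n # y # xs) z
     \<Longrightarrow> eval (PrimRec g h) (Suc n # xs) z"
| eval_Mu: "eval f (n # xs) 0 \<Longrightarrow> (\<forall>m<n. \<exists>k. eval f (m # xs) (Suc k))
     \<Longrightarrow> eval (Mu f) xs n"

text \<open>Finite binary sequences (Xi) are bool lists; bijective coding into nat.\<close>
fun list_code :: "bool list \<Rightarrow> nat" where
  "list_code [] = 0"
| "list_code (b # bs) = 2 * list_code bs + (if b then 2 else 1)"

definition pair_code :: "bool list \<times> bool list \<Rightarrow> nat" where
  "pair_code p = prod_encode (list_code (fst p), list_code (snd p))"

definition rat_decode :: "nat \<Rightarrow> real" where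
  "rat_decode n = (case prod_decode n of (a, b) \<Rightarrow> real_of_int (int_decode a) / real (Suc b))"

text \<open>Infinite binary sequences (Omega) are functions nat => bool; omega_i is w (i-1).\<close>
definition pref :: "(nat \<Rightarrow> bool) \<Rightarrow> nat \<Rightarrow> bool list" where
  "pref w n = map w [0..<n]"

definition is_prefix_of :: "bool list \<Rightarrow> (nat \<Rightarrow> bool) \<Rightarrow> bool" where
  "is_prefix_of x w \<longleftrightarrow> x = pref w (length x)"

definition L :: "(nat \<Rightarrow> bool) measure" where
  "L = (\<Pi>\<^sub>M i\<in>UNIV. measure_pmf (bernoulli_pmf (1/2)))"

definition re_set :: "(bool list \<times> bool list) set \<Rightarrow> bool" where
  "re_set S \<longleftrightarrow> (\<exists>c. \<forall>p. p \<in> S \<longleftrightarrow> (\<exists>v. eval c [pair_code p] v))"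

definition computable_operation :: "(bool list \<times> bool list) set \<Rightarrow> bool" where
  "computable_operation Fh \<longleftrightarrow> re_set Fh
     \<and> (\<forall>x. (x, []) \<in> Fh)
     \<and> (\<forall>x y x' y'. (x, y) \<in> Fh \<longrightarrow> (x', y') \<in> Fh \<longrightarrow> prefix x x'
           \<longrightarrow> prefix y y' \<or> prefix y' y)"

text \<open>F(alpha) = sup {y. x prefix of alpha, (x,y) in Fh} is the infinite sequence w.\<close>
definition op_output :: "(bool list \<times> bool list) set \<Rightarrow> (nat \<Rightarrow> bool) \<Rightarrow> (nat \<Rightarrow> bool) \<Rightarrow> bool" where
  "op_output Fh \<alpha> w \<longleftrightarrow>
     (\<forall>x y. is_prefix_of x \<alpha> \<longrightarrow> (x, y) \<in> Fh \<longrightarrow> is_prefix_of y w)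
   \<and> (\<forall>n. \<exists>x y. is_prefix_of x \<alpha> \<and> (x, y) \<in> Fh \<and> n \<le> length y)"

text \<open>Algorithm c computes the partial real function f (with values in [0,1]):
  on input (x, kappa) (kappa a positive rational, given by any code k) it either
  outputs (a code of) a rational within kappa of f x, or does not halt; f x is
  defined iff it halts for every kappa.\<close>
definition computes_forecast :: "recf \<Rightarrow> (bool list \<Rightarrow> real option) \<Rightarrow> bool" where
  "computes_forecast c f \<longleftrightarrow>
     (\<forall>x. (f x \<noteq> None \<longleftrightarrow>
             (\<forall>k. rat_decode k > 0 \<longrightarrow> (\<exists>v. eval c [prod_encode (list_code x, k)] v)))
        \<and> (\<forall>r k v. f x = Some r \<longrightarrow> rat_decode k > 0 \<longrightarrow> eval c [prod_encode (list_code x, k)] v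
              \<longrightarrow> \<bar>rat_decode v - r\<bar> \<le> rat_decode k)
        \<and> (\<forall>r. f x = Some r \<longrightarrow> 0 \<le> r \<and> r \<le> 1))"

definition forecasting_algorithm :: "(bool list \<Rightarrow> real option) \<Rightarrow> bool" where
  "forecasting_algorithm f \<longleftrightarrow> (\<exists>c. computes_forecast c f)"

definition computes_selection :: "recf \<Rightarrow> (bool list \<Rightarrow> nat option) \<Rightarrow> bool" where
  "computes_selection d \<delta> \<longleftrightarrow>
     (\<forall>x. (\<forall>v. \<delta> x = Some v \<longrightarrow> v \<le> 1)
        \<and> (\<forall>v. eval d [list_code x] v \<longleftrightarrow> \<delta> x = Some v))"

definition computable_selection_rule :: "(bool list \<Rightarrow> nat option) \<Rightarrow> bool" where
  "computable_selection_rule \<delta> \<longleftrightarrow> (\<exists>d. computes_selection d \<delta>)"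

definition bit :: "bool \<Rightarrow> real" where
  "bit b = (if b then 1 else 0)"

end

theory Submission
  imports Defs
begin

text \<open>
  The output is written in blocks, each much longer than everything before it, and every program
  \<open>e\<close> is responsible for infinitely many blocks. At its block, after the prefix \<open>z\<close>, program
  \<open>e\<close> is tried if it has already been seen to halt on all prefixes up to the end of the last block
  where it was tried. Normally the block is filled with fresh random bits. But with a small
  probability \<open>2 ^ -(e + c0)\<close> a try is reserved: then the process waits for some continuation
  of \<open>z\<close> through the block on which \<open>e\<close> halts everywhere and its forecasts are off by more than
  a third of the length of the block, and outputs the first one found.

  If no such continuation exists, then the reserved outcomes are lost. But against any forecast a
  random block has expected loss one half, so \<open>e\<close> is defined along at most three quarters of the
  random continuations, and on the others it is never tried again. Hence the expected number of
  such hopeless tries is at most 4, and the total probability of waiting forever is at most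
  \<open>\<Sum>e. 4 * 2 ^ -(e + c0)\<close>. If \<open>e\<close> is defined along the whole output, then it is tried infinitely
  often, so almost surely infinitely many of its tries are reserved.

  A selection rule can carry out the same search: on a block where \<open>e\<close> is tried, it selects the
  positions on the continuation found where the next bit is 1 (or 0). It is total along the
  output up to finitely many hopeless tries, and on each reserved block one of the two rules
  collects half of the loss.
\<close>

section \<open>Computable functions of natural numbers\<close>

text \<open>The obstacle is that forecasts are partial. No algorithm can tell whether waiting for a
  bad continuation will ever end, and a program may be undefined exactly where its forecasts would
  fail. A hopeless try therefore has to cost the program something, and the cost is the risk of
  being undefined on the block that is actually written.

  Two demands shape the reservation probability. Its sum over all programs must be small, to bound
  the chance of waiting forever. For each fixed program it must be the same at every try, so that
  infinitely many tries almost surely contain infinitely many reservations.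

  The threshold of one third lies below the mean loss 1/2, which leaves a definite fraction of the
  blocks above it. It is also large enough for the final bound: 1/50 is lost to precision and
  rounding, one of two rules gets half of the rest, and (1/3 - 1/50) / 2 exceeds 3/20. The gap
  between 3/20 and 1/8 absorbs the influence of the earlier blocks.

  Evaluation has no notion of running time, so all searches run over the stages of an inductive
  derivation system, which are finite and computable.\<close>

definition recfn :: "nat \<Rightarrow> (nat list \<Rightarrow> nat) \<Rightarrow> bool" where
  "recfn n F \<longleftrightarrow> (\<exists>c. \<forall>xs. length xs = n \<longrightarrow> eval c xs (F xs))"

lemma recfn_cong:
  "recfn n F \<Longrightarrow> (\<And>xs. length xs = n \<Longrightarrow> F xs = G xs) \<Longrightarrow> recfn n G"
  unfolding recfn_def by metis

lemma recfn_proj: "i < n \<Longrightarrow> recfn n (\<lambda>xs. xs ! i)"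
  unfolding recfn_def by (metis eval_Proj)

lemma recfn_Comp:
  assumes "recfn (length Gs) F" "\<And>G. G \<in> set Gs \<Longrightarrow> recfn n G"
  shows "recfn n (\<lambda>xs. F (map (\<lambda>G. G xs) Gs))"
proof -
  obtain c where c: "\<And>xs. length xs = length Gs \<Longrightarrow> eval c xs (F xs)"
    using assms(1) unfolding recfn_def by blast
  define g where "g G = (SOME d. \<forall>xs. length xs = n \<longrightarrow> eval d xs (G xs))" for G
  have g: "eval (g G) xs (G xs)" if "G \<in> set Gs" "length xs = n" for G xs
    using someI_ex[OF assms(2)[OF that(1), unfolded recfn_def]] that(2) unfolding g_def by blast
  have "eval (Comp c (map g Gs)) xs (F (map (\<lambda>G. G xs) Gs))" if "length xs = n" for xs
  proof (rule eval_Comp)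
    show "list_all2 (\<lambda>h y. eval h xs y) (map g Gs) (map (\<lambda>G. G xs) Gs)"
      using g that by (auto simp: list_all2_map1 list_all2_map2 intro!: list.rel_refl_strong)
  qed (simp add: c)
  then show ?thesis unfolding recfn_def by blast
qed

lemma recfn_Suc:
  assumes "recfn n a" shows "recfn n (\<lambda>xs. Suc (a xs))"
proof -
  have "recfn 1 (\<lambda>xs. Suc (xs ! 0))"
    unfolding recfn_def
    by (rule exI[of _ Succ]) (auto simp: length_Suc_conv intro: eval_Succ)
  from recfn_Comp[of "[a]", simplified, OF _ assms, of "\<lambda>xs. Suc (xs ! 0)"] this
  show ?thesis by simp
qed

lemma recfn_const: "recfn n (\<lambda>_. k)"
proof (induction k)
  case 0
  then show ?case unfolding recfn_def using eval_Zero by blast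
next
  case (Suc k)
  then show ?case by (rule recfn_Suc)
qed

lemma recfn_rec:
  assumes "recfn n a" "recfn n m"
    and "recfn (Suc (Suc n)) (\<lambda>ys. g (ys ! 0) (ys ! 1) (drop 2 ys))"
  shows "recfn n (\<lambda>xs. rec_nat (a xs) (\<lambda>k r. g k r xs) (m xs))"
proof -
  obtain ca where ca: "\<And>xs. length xs = n \<Longrightarrow> eval ca xs (a xs)"
    using assms(1) unfolding recfn_def by blast
  obtain cg where cg: "\<And>ys. length ys = Suc (Suc n) \<Longrightarrow> eval cg ys (g (ys ! 0) (ys ! 1) (drop 2 ys))"
    using assms(3) unfolding recfn_def by blast
  have *: "eval (PrimRec ca cg) (k # xs) (rec_nat (a xs) (\<lambda>k r. g k r xs) k)"
    if "length xs = n" for k xs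
  proof (induction k)
    case 0
    then show ?case by (auto intro!: eval_Prim0 ca that)
  next
    case (Suc k)
    have "eval cg (k # rec_nat (a xs) (\<lambda>k r. g k r xs) k # xs)
       (g k (rec_nat (a xs) (\<lambda>k r. g k r xs) k) xs)"
      using cg[of "k # rec_nat (a xs) (\<lambda>k r. g k r xs) k # xs"] that by simp
    with Suc show ?case by (auto intro: eval_PrimS)
  qed
  define F where "F ys = rec_nat (a (tl ys)) (\<lambda>k r. g k r (tl ys)) (hd ys)" for ys
  have "recfn (Suc n) F"
    unfolding recfn_def F_def
    by (rule exI[of _ "PrimRec ca cg"]) (auto simp: length_Suc_conv *)
  \<comment> \<open>\<open>PrimRec\<close> recurses on its first argument only; supplying
    \<open>m\<close> together with all projections allows any computable recursion length.\<close>
  then have "recfn n (\<lambda>xs. F (map (\<lambda>G. G xs) (m # map (\<lambda>i xs. xs ! i) [0..<n])))"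
    using assms(2) by (intro recfn_Comp) (auto intro: recfn_proj)
  then show ?thesis
    by (rule recfn_cong) (auto simp: F_def comp_def map_nth[symmetric], metis map_nth)
qed

lemma recfn_add:
  assumes "recfn n a" "recfn n b" shows "recfn n (\<lambda>xs. a xs + b xs)"
proof -
  have "recfn n (\<lambda>xs. rec_nat (a xs) (\<lambda>k r. Suc r) (b xs))"
    by (intro recfn_rec assms recfn_Suc recfn_proj) simp
  moreover have "rec_nat x (\<lambda>k r. Suc r) y = x + y" for x y by (induction y) auto
  ultimately show ?thesis by simp
qed

lemma recfn_diff:
  assumes "recfn n a" "recfn n b" shows "recfn n (\<lambda>xs. a xs - b xs)"
proof -
  have pred: "recfn m (\<lambda>xs. c xs - 1)" if "recfn m c" for m c
  proof -
    have "recfn m (\<lambda>xs. rec_nat 0 (\<lambda>k r. k) (c xs))"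
      by (intro recfn_rec that recfn_const recfn_proj) simp
    moreover have "rec_nat 0 (\<lambda>k r. k) y = y - 1" for y :: nat by (cases y) auto
    ultimately show ?thesis by simp
  qed
  have "recfn n (\<lambda>xs. rec_nat (a xs) (\<lambda>k r. r - 1) (b xs))"
    by (intro recfn_rec assms pred recfn_proj) simp
  moreover have "rec_nat x (\<lambda>k r. r - 1) y = x - y" for x y :: nat by (induction y) auto
  ultimately show ?thesis by simp
qed

lemma recfn_if_le:
  assumes "recfn n a" "recfn n b" "recfn n c" "recfn n d"
  shows "recfn n (\<lambda>xs. if a xs \<le> b xs then c xs else d xs)"
proof -
  \<comment> \<open>A recursion of length \<open>a xs - b xs\<close> serves as a case distinction:
    no step leaves \<open>c xs\<close>, and any positive number of steps yields
    \<open>d xs\<close>.\<close>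
  have "recfn n (\<lambda>xs. rec_nat (c xs) (\<lambda>k r. d (id xs)) (a xs - b xs))"
  proof (intro recfn_rec recfn_diff assms)
    have "recfn (Suc (Suc n)) (\<lambda>ys. d (map (\<lambda>G. G ys) (map (\<lambda>i ys. ys ! (i + 2)) [0..<n])))"
      using assms(4) by (intro recfn_Comp) (auto intro: recfn_proj)
    then show "recfn (Suc (Suc n)) (\<lambda>ys. d (id (drop 2 ys)))"
    proof (rule recfn_cong)
      fix ys :: "nat list" assume "length ys = Suc (Suc n)"
      then have "map (\<lambda>G. G ys) (map (\<lambda>i ys. ys ! (i + 2)) [0..<n]) = drop 2 ys"
        by (auto intro!: nth_equalityI simp: add.commute)
      then show "d (map (\<lambda>G. G ys) (map (\<lambda>i ys. ys ! (i + 2)) [0..<n])) = d (id (drop 2 ys))"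
        by simp
    qed
  qed
  moreover have "rec_nat x (\<lambda>k r. y) z = (if z = 0 then x else y)" for x y z :: nat
    by (cases z) auto
  ultimately show ?thesis by (auto elim!: recfn_cong)
qed

section \<open>Inverting the pairing function\<close>

lemma recfn_triangle:
  assumes "recfn n a" shows "recfn n (\<lambda>xs. triangle (a xs))"
proof -
  have "recfn n (\<lambda>xs. rec_nat 0 (\<lambda>k r. r + Suc k) (a xs))"
    by (intro recfn_rec assms recfn_const recfn_proj recfn_add recfn_Suc) simp_all
  moreover have "rec_nat 0 (\<lambda>k r. r + Suc k) y = triangle y" for y by (induction y) auto
  ultimately show ?thesis by simp
qed

definition pfst :: "nat \<Rightarrow> nat" where "pfst x = fst (prod_decode x)"
definition psnd :: "nat \<Rightarrow> nat" where "psnd x = snd (prod_decode x)"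
definition pair :: "nat \<Rightarrow> nat \<Rightarrow> nat" where "pair x y = prod_encode (x, y)"

lemma pfst_pair [simp]: "pfst (pair x y) = x" and psnd_pair [simp]: "psnd (pair x y) = y"
  by (simp_all add: pfst_def psnd_def pair_def)

lemma pair_pfst_psnd [simp]: "pair (pfst x) (psnd x) = x"
  by (simp add: pfst_def psnd_def pair_def)

lemma pair_inject [simp]: "pair x y = pair x' y' \<longleftrightarrow> x = x' \<and> y = y'"
  by (simp add: pair_def)

lemma le_pair: "x \<le> pair x y" "y \<le> pair x y"
  by (simp_all add: pair_def le_prod_encode_1 le_prod_encode_2)

lemma recfn_pair:
  assumes "recfn n a" "recfn n b" shows "recfn n (\<lambda>xs. pair (a xs) (b xs))"
  unfolding pair_def prod_encode_def
  by (auto intro!: recfn_add recfn_triangle assms)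

text \<open>The index of the antidiagonal on which the pair coded by \<open>x\<close> lies.\<close>
definition diag :: "nat \<Rightarrow> nat" where
  "diag x = rec_nat 0 (\<lambda>k r. if triangle (Suc r) \<le> Suc k then Suc r else r) x"

lemma diag_bounds: "triangle (diag x) \<le> x \<and> x < triangle (Suc (diag x))"
  by (induction x) (auto simp: diag_def)

text \<open>Both numbers bracket \<open>x\<close> between consecutive triangle numbers, and by
  monotonicity only one index can do so. This makes the projections primitive recursive.\<close>

lemma diag_eq: "diag x = pfst x + psnd x"
proof -
  have mono: "triangle a \<le> triangle b" if "a \<le> b" for a b
    using that by (induction b) (auto simp: le_Suc_eq)
  have *: "triangle (pfst x + psnd x) \<le> x" "x < triangle (Suc (pfst x + psnd x))"
    using pair_pfst_psnd[of x] unfolding pair_def prod_encode_def by auto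
  have "\<not> diag x < pfst x + psnd x"
    using mono[of "Suc (diag x)" "pfst x + psnd x"] diag_bounds[of x] * by auto
  moreover have "\<not> pfst x + psnd x < diag x"
    using mono[of "Suc (pfst x + psnd x)" "diag x"] diag_bounds[of x] * by auto
  ultimately show ?thesis by simp
qed

lemma recfn_diag:
  assumes "recfn n a" shows "recfn n (\<lambda>xs. diag (a xs))"
  unfolding diag_def
  by (intro recfn_rec recfn_if_le recfn_triangle recfn_Suc recfn_const assms recfn_proj) simp_all

lemma recfn_pfst:
  assumes "recfn n a" shows "recfn n (\<lambda>xs. pfst (a xs))"
proof -
  \<comment> \<open>The pair \<open>(m, n)\<close> is coded as \<open>triangle (m + n) + m\<close>,
    so the offset on the antidiagonal is the first component.\<close>
  have "x - triangle (diag x) = pfst x" for x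
    unfolding diag_eq by (subst (1) pair_pfst_psnd[symmetric]) (simp add: pair_def prod_encode_def)
  moreover have "recfn n (\<lambda>xs. a xs - triangle (diag (a xs)))"
    by (intro recfn_diff recfn_triangle recfn_diag assms)
  ultimately show ?thesis by simp
qed

lemma recfn_psnd:
  assumes "recfn n a" shows "recfn n (\<lambda>xs. psnd (a xs))"
proof -
  have "recfn n (\<lambda>xs. diag (a xs) - pfst (a xs))"
    by (intro recfn_diff recfn_pfst recfn_diag assms)
  then show ?thesis by (simp add: diag_eq)
qed

text \<open>From here on functions are unary and several arguments are packed by
  \<open>pair\<close>; the closure rules then apply as plain introduction rules, without any arity
  bookkeeping.\<close>

definition computable :: "(nat \<Rightarrow> nat) \<Rightarrow> bool" where
  "computable f \<longleftrightarrow> recfn 1 (\<lambda>xs. f (xs ! 0))"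

definition decidable :: "(nat \<Rightarrow> bool) \<Rightarrow> bool" where
  "decidable P \<longleftrightarrow> computable (\<lambda>x. of_bool (P x))"

lemma recfn_computable:
  assumes "computable f" "recfn n a" shows "recfn n (\<lambda>xs. f (a xs))"
  using recfn_Comp[of "[a]" "\<lambda>xs. f (xs ! 0)" n] assms unfolding computable_def by simp

lemma computable_id: "computable (\<lambda>x. x)"
  and computable_const: "computable (\<lambda>x. k)"
  and computable_Suc: "computable a \<Longrightarrow> computable (\<lambda>x. Suc (a x))"
  and computable_pfst: "computable a \<Longrightarrow> computable (\<lambda>x. pfst (a x))"
  and computable_psnd: "computable a \<Longrightarrow> computable (\<lambda>x. psnd (a x))"
  and computable_pair: "computable a \<Longrightarrow> computable b \<Longrightarrow> computable (\<lambda>x. pair (a x) (b x))"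
  and computable_add: "computable a \<Longrightarrow> computable b \<Longrightarrow> computable (\<lambda>x. a x + b x)"
  and computable_diff: "computable a \<Longrightarrow> computable b \<Longrightarrow> computable (\<lambda>x. a x - b x)"
  unfolding computable_def
  by (auto intro!: recfn_proj recfn_const recfn_Suc recfn_pfst recfn_psnd recfn_pair recfn_add recfn_diff)

lemma computable_rec:
  assumes "computable a" "computable m"
    and "computable (\<lambda>p. g (pfst p) (pfst (psnd p)) (psnd (psnd p)))"
  shows "computable (\<lambda>x. rec_nat (a x) (\<lambda>k r. g k r x) (m x))"
  unfolding computable_def
proof (rule recfn_rec)
  have "recfn 3 (\<lambda>ys. g (pfst (pair (ys ! 0) (pair (ys ! 1) (ys ! 2))))
      (pfst (psnd (pair (ys ! 0) (pair (ys ! 1) (ys ! 2)))))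
      (psnd (psnd (pair (ys ! 0) (pair (ys ! 1) (ys ! 2))))))"
    by (rule recfn_computable[OF assms(3)]) (auto intro!: recfn_pair recfn_proj)
  then show "recfn (Suc (Suc 1)) (\<lambda>ys. g (ys ! 0) (ys ! 1) (drop 2 ys ! 0))"
    by (auto elim!: recfn_cong simp: numeral_3_eq_3)
qed (use assms in \<open>auto simp: computable_def\<close>)

lemma computable_mult:
  assumes "computable a" "computable b" shows "computable (\<lambda>x. a x * b x)"
proof -
  have "computable (\<lambda>x. rec_nat 0 (\<lambda>k r. r + a x) (b x))"
    by (intro computable_rec computable_const computable_add computable_pfst computable_psnd computable_id assms
       recfn_computable[OF assms(1), of 1, folded computable_def])
      (use recfn_computable[OF assms(1), of 1] in \<open>auto simp: computable_def intro!: recfn_psnd recfn_proj\<close>)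
  moreover have "rec_nat 0 (\<lambda>k r. r + x) y = x * y" for x y :: nat by (induction y) auto
  ultimately show ?thesis by simp
qed

lemma computable_comp:
  assumes "computable f" "computable a" shows "computable (\<lambda>x. f (a x))"
  using recfn_computable[OF assms(1), of 1 "\<lambda>xs. a (xs ! 0)"] assms(2)
  by (simp add: computable_def)

lemma computable_power2:
  assumes "computable b" shows "computable (\<lambda>x. 2 ^ b x)"
proof -
  have "computable (\<lambda>x. rec_nat 1 (\<lambda>k r. r + r) (b x))"
    by (intro computable_rec computable_const computable_add computable_pfst computable_psnd computable_id assms)
  moreover have "rec_nat 1 (\<lambda>k r. r + r) y = (2::nat) ^ y" for y by (induction y) auto
  ultimately show ?thesis by simp
qed

lemma decidable_le:
  assumes "computable a" "computable b" shows "decidable (\<lambda>x. a x \<le> b x)"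
proof -
  have "computable (\<lambda>x. 1 - (a x - b x))"
    by (intro computable_diff computable_const assms)
  moreover have "1 - (m - n) = (of_bool (m \<le> n) :: nat)" for m n :: nat by auto
  ultimately show ?thesis unfolding decidable_def by simp
qed

lemma decidable_conj:
  assumes "decidable P" "decidable Q" shows "decidable (\<lambda>x. P x \<and> Q x)"
  using computable_mult[OF assms[unfolded decidable_def]] unfolding decidable_def
  by (simp add: of_bool_conj)

lemma decidable_not:
  assumes "decidable P" shows "decidable (\<lambda>x. \<not> P x)"
proof -
  have "computable (\<lambda>x. 1 - of_bool (P x))"
    by (intro computable_diff computable_const assms[unfolded decidable_def])
  moreover have "1 - of_bool b = (of_bool (\<not> b) :: nat)" for b by simp
  ultimately show ?thesis unfolding decidable_def by simp
qed

lemma decidable_disj: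
  assumes "decidable P" "decidable Q" shows "decidable (\<lambda>x. P x \<or> Q x)"
proof -
  have "decidable (\<lambda>x. \<not> (\<not> P x \<and> \<not> Q x))"
    by (intro decidable_not decidable_conj assms)
  then show ?thesis by simp
qed

lemma decidable_imp:
  assumes "decidable P" "decidable Q" shows "decidable (\<lambda>x. P x \<longrightarrow> Q x)"
  unfolding imp_conv_disj by (intro decidable_disj decidable_not assms)

lemma decidable_less:
  assumes "computable a" "computable b" shows "decidable (\<lambda>x. a x < b x)"
  using decidable_not[OF decidable_le[OF assms(2,1)]] by (simp add: not_le)

lemma decidable_eq:
  assumes "computable a" "computable b" shows "decidable (\<lambda>x. a x = b x)"
  using decidable_conj[OF decidable_le[OF assms(1,2)] decidable_le[OF assms(2,1)]] by (simp add: eq_iff)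

lemma computable_of_bool: "decidable P \<Longrightarrow> computable (\<lambda>x. of_bool (P x))"
  unfolding decidable_def .

lemma computable_if:
  assumes "decidable P" "computable a" "computable b"
  shows "computable (\<lambda>x. if P x then a x else b x)"
proof -
  have "computable (\<lambda>x. of_bool (P x) * a x + (1 - of_bool (P x)) * b x)"
    using assms unfolding decidable_def
    by (intro computable_add computable_mult computable_diff computable_const)
  moreover have "of_bool p * m + (1 - of_bool p) * n = (if p then m else n)" for p and m n :: nat
    by simp
  ultimately show ?thesis by simp
qed

lemma computable_sum:
  assumes "computable n" "computable (\<lambda>p. f (pfst p) (psnd p))"
  shows "computable (\<lambda>x. \<Sum>i<n x. f i x)"
proof -
  have "computable (\<lambda>p. f (pfst p) (psnd (psnd p)))"
    using computable_comp[OF assms(2), of "\<lambda>p. pair (pfst p) (psnd (psnd p))"]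
    by (simp add: computable_pair computable_pfst computable_psnd computable_id)
  then have "computable (\<lambda>x. rec_nat 0 (\<lambda>k r. r + f k x) (n x))"
    by (intro computable_rec computable_const computable_add computable_pfst computable_psnd
        computable_id assms)
  moreover have "rec_nat 0 (\<lambda>k r. r + f k x) m = (\<Sum>i<m. f i x)" for m x by (induction m) auto
  ultimately show ?thesis by simp
qed

text \<open>A bounded search is a sum of indicators tested for being positive; this avoids an
  unbounded \<open>Mu\<close> wherever a bound is at hand.\<close>

lemma decidable_bex:
  assumes "computable n" "decidable (\<lambda>p. P (pfst p) (psnd p))"
  shows "decidable (\<lambda>x. \<exists>i<n x. P i x)"
proof -
  have "decidable (\<lambda>x. \<not> (\<Sum>i<n x. of_bool (P i x)) \<le> (0::nat))"
    by (intro decidable_not decidable_le computable_sum assms computable_const assms(2)[unfolded decidable_def])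
  moreover have "(\<not> (\<Sum>i<m. of_bool (P i x)) \<le> (0::nat)) \<longleftrightarrow> (\<exists>i<m. P i x)" for m x
    by (auto simp: sum_eq_0_iff)
  ultimately show ?thesis by simp
qed

lemma decidable_ball:
  assumes "computable n" "decidable (\<lambda>p. P (pfst p) (psnd p))"
  shows "decidable (\<lambda>x. \<forall>i<n x. P i x)"
proof -
  have "decidable (\<lambda>x. \<not> (\<exists>i<n x. \<not> P i x))"
    by (intro decidable_not decidable_bex assms)
  then show ?thesis by simp
qed

lemma computable_div:
  assumes "computable a" "computable b" shows "computable (\<lambda>x. a x div b x)"
proof -
  \<comment> \<open>The quotient counts the positive multiples of the divisor up to
    \<open>a x\<close>; division by zero is separated because its value is 0 by convention.\<close>
  have "computable (\<lambda>x. if b x = 0 then 0 else \<Sum>i<a x. of_bool (b x * Suc i \<le> a x))"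
    by (intro computable_if decidable_eq computable_sum computable_of_bool decidable_le computable_mult
        computable_Suc computable_const computable_pfst computable_id assms
        computable_comp[OF assms(1)] computable_comp[OF assms(2)] computable_psnd)
  moreover have "(if n = 0 then 0 else \<Sum>i<m. of_bool (n * Suc i \<le> m)) = m div n" for m n :: nat
  proof (cases "n = 0")
    case False
    have "{i. i < m \<and> n * Suc i \<le> m} = {..<m div n}"
    proof -
      have "i < m" if "n * Suc i \<le> m" for i
        using that False by (metis Suc_le_lessD le_trans mult_le_mono1 nat_mult_1 not_gr0 One_nat_def Suc_leI)
      moreover have "n * Suc i \<le> m \<longleftrightarrow> i < m div n" for i
        using False by (metis Suc_le_eq less_eq_div_iff_mult_less_eq mult.commute not_gr0)
      ultimately show ?thesis by auto
    qed
    with False show ?thesis by (simp add: Int_def)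
  qed simp
  ultimately show ?thesis by simp
qed

lemma decidable_odd:
  assumes "computable a" shows "decidable (\<lambda>x. odd (a x))"
proof -
  have "decidable (\<lambda>x. 2 * (a x div 2) < a x)"
    by (intro decidable_less computable_mult computable_div computable_const assms)
  moreover have "2 * (n div 2) < n \<longleftrightarrow> odd n" for n :: nat by presburger
  ultimately show ?thesis by simp
qed

lemma decidable_even: "computable a \<Longrightarrow> decidable (\<lambda>x. even (a x))"
  using decidable_not[OF decidable_odd, of a] by simp

lemmas comp_intros =
  computable_id computable_const computable_Suc computable_pfst computable_psnd computable_pair
  computable_add computable_diff computable_mult computable_power2 computable_div computable_of_bool
  computable_if computable_sum decidable_le decidable_less decidable_eq decidable_conj decidable_disj
  decidable_imp decidable_not decidable_ball decidable_bex decidable_odd decidable_even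

section \<open>A universal machine\<close>

text \<open>Triples \<open>(e, xs, v)\<close> stating that the program with code \<open>e\<close> returns \<open>v\<close> on \<open>xs\<close>.
  Tag 6 is a judgement on lists of programs with list-valued results, and \<open>Proj\<close> is evaluated by
  walking down the argument list, so that checking one inference needs no list recursion.\<close>

definition triple :: "nat \<Rightarrow> nat \<Rightarrow> nat \<Rightarrow> nat" where
  "triple e xs v = pair e (pair xs v)"

definition cons_code :: "nat \<Rightarrow> nat \<Rightarrow> nat" where
  "cons_code x xs = Suc (pair x xs)"

definition justified :: "nat \<Rightarrow> nat set \<Rightarrow> nat \<Rightarrow> nat \<Rightarrow> nat \<Rightarrow> bool" where
  "justified s S e xs v \<longleftrightarrow>
     (pfst e = 0 \<and> v = 0)
   \<or> (pfst e = 1 \<and> xs \<noteq> 0 \<and> v = Suc (pfst (xs - 1)))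
   \<or> (pfst e = 2 \<and> xs \<noteq> 0 \<and> (if psnd e = 0 then v = pfst (xs - 1)
        else triple (pair 2 (psnd e - 1)) (psnd (xs - 1)) v \<in> S))
   \<or> (pfst e = 3 \<and> (\<exists>ys<s. triple (pair 6 (psnd (psnd e))) xs ys \<in> S
        \<and> triple (pfst (psnd e)) ys v \<in> S))
   \<or> (pfst e = 4 \<and> xs \<noteq> 0 \<and> (if pfst (xs - 1) = 0
        then triple (pfst (psnd e)) (psnd (xs - 1)) v \<in> S
        else (\<exists>y<s. triple e (cons_code (pfst (xs - 1) - 1) (psnd (xs - 1))) y \<in> S
          \<and> triple (psnd (psnd e)) (cons_code (pfst (xs - 1) - 1) (cons_code y (psnd (xs - 1)))) v \<in> S)))
   \<or> (pfst e = 5 \<and> triple (psnd e) (cons_code v xs) 0 \<in> S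
        \<and> (\<forall>m<v. \<exists>k<s. triple (psnd e) (cons_code m xs) (Suc k) \<in> S))
   \<or> (pfst e = 6 \<and> (if psnd e = 0 then v = 0
        else v \<noteq> 0 \<and> triple (pfst (psnd e - 1)) xs (pfst (v - 1)) \<in> S
          \<and> triple (pair 6 (psnd (psnd e - 1))) xs (psnd (v - 1)) \<in> S))"

text \<open>Stages play the part of running time. Restricting stage \<open>Suc s\<close> to codes
  below \<open>s\<close> keeps every stage finite, hence coded by a number; the price is that
  monotonicity has to be proved.\<close>

primrec derivable :: "nat \<Rightarrow> nat set" where
  "derivable 0 = {}"
| "derivable (Suc s) = {t. t < s \<and> justified s (derivable s) (pfst t) (pfst (psnd t)) (psnd (psnd t))}"

lemma derivable_less: "t \<in> derivable s \<Longrightarrow> t < s"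
  by (cases s) auto

lemma finite_derivable: "finite (derivable s)"
  by (rule finite_subset[of _ "{..<s}"]) (auto dest: derivable_less)

text \<open>The stage occurs only positively, in memberships and as a bound of existential
  quantifiers; the universal quantifier in the clause for minimisation is bounded by the value
  \<open>v\<close> instead.\<close>

lemma justified_mono:
  assumes "s \<le> s'" "S \<subseteq> S'" "justified s S e xs v"
  shows "justified s' S' e xs v"
proof -
  have ex: "(\<exists>k<s. P k) \<Longrightarrow> (\<And>k. P k \<Longrightarrow> P' k) \<Longrightarrow> (\<exists>k<s'. P' k)" for P P' :: "nat \<Rightarrow> bool"
    using assms(1) by (meson less_le_trans)
  have sub: "t \<in> S \<Longrightarrow> t \<in> S'" for t
    using assms(2) by blast
  consider "pfst e = 0" | "pfst e = 1" | "pfst e = 2" | "pfst e = 3" | "pfst e = 4" | "pfst e = 5" | "pfst e = 6"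
    using assms(3) unfolding justified_def by argo
  then show ?thesis
  proof cases
    case 3
    then show ?thesis
      using assms(3) sub unfolding justified_def by (simp split: if_splits)
  next
    case 4
    with assms(3) have "\<exists>ys<s. triple (pair 6 (psnd (psnd e))) xs ys \<in> S \<and> triple (pfst (psnd e)) ys v \<in> S"
      by (simp add: justified_def)
    then have "\<exists>ys<s'. triple (pair 6 (psnd (psnd e))) xs ys \<in> S' \<and> triple (pfst (psnd e)) ys v \<in> S'"
      by (rule ex) (simp add: sub)
    with 4 show ?thesis by (simp add: justified_def)
  next
    case 5
    show ?thesis
    proof (cases "pfst (xs - 1) = 0")
      case True
      then show ?thesis
        using assms(3) sub 5 unfolding justified_def by simp
    next
      case False
      define n where "n = pfst (xs - 1) - 1"
      have xs: "xs \<noteq> 0" and "\<exists>y<s. triple e (cons_code n (psnd (xs - 1))) y \<in> S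
          \<and> triple (psnd (psnd e)) (cons_code n (cons_code y (psnd (xs - 1)))) v \<in> S"
        using assms(3) 5 False unfolding n_def by (simp_all add: justified_def)
      from this(2) have "\<exists>y<s'. triple e (cons_code n (psnd (xs - 1))) y \<in> S'
          \<and> triple (psnd (psnd e)) (cons_code n (cons_code y (psnd (xs - 1)))) v \<in> S'"
        by (rule ex) (simp add: sub)
      with 5 False xs show ?thesis unfolding n_def by (simp add: justified_def)
    qed
  next
    case 6
    have "\<exists>k<s'. triple (psnd e) (cons_code m xs) (Suc k) \<in> S'" if "m < v" for m
    proof -
      have "\<exists>k<s. triple (psnd e) (cons_code m xs) (Suc k) \<in> S"
        using assms(3) 6 that by (simp add: justified_def)
      then show ?thesis by (rule ex) (simp add: sub)
    qed
    with 6 assms(3) sub show ?thesis by (simp add: justified_def)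
  next
    case 7
    then show ?thesis
      using assms(3) sub unfolding justified_def by (simp split: if_splits)
  qed (use assms(3) in \<open>simp_all add: justified_def\<close>)
qed

lemma derivable_Suc_mono: "derivable s \<subseteq> derivable (Suc s)"
proof (induction s)
  case (Suc s)
  have "t \<in> derivable (Suc (Suc s))" if "t \<in> derivable (Suc s)" for t
    using that Suc justified_mono[OF le_SucI[OF order_refl] Suc, of s] by auto
  then show ?case by blast
qed simp

lemma derivable_mono: "s \<le> s' \<Longrightarrow> derivable s \<subseteq> derivable s'"
  by (rule lift_Suc_mono_le[of derivable, OF derivable_Suc_mono])

lemma derivableI:
  assumes "justified s (derivable s) e xs v" shows "\<exists>s. triple e xs v \<in> derivable s"
proof -
  \<comment> \<open>The stage must also exceed the code of the triple itself, because larger codes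
    are cut off.\<close>
  define u where "u = max s (Suc (triple e xs v))"
  have "justified u (derivable u) e xs v"
    using justified_mono[OF _ derivable_mono assms] by (simp add: u_def)
  then have "triple e xs v \<in> derivable (Suc u)"
    by (simp add: triple_def u_def)
  then show ?thesis ..
qed

lemma derivable_unique:
  "triple e xs v \<in> derivable s \<Longrightarrow> triple e xs v' \<in> derivable s \<Longrightarrow> v = v'"
proof (induction s arbitrary: e xs v v')
  case (Suc s)
  have j: "justified s (derivable s) e xs v" and j': "justified s (derivable s) e xs v'"
    using Suc.prems by (auto simp: triple_def)
  consider "pfst e = 0" | "pfst e = 1" | "pfst e = 2" | "pfst e = 3" | "pfst e = 4" | "pfst e = 5" | "pfst e = 6"
    using j unfolding justified_def by argo
  then show ?case
  proof cases
    case 3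
    with j j' Suc.IH show ?thesis unfolding justified_def by (simp split: if_splits) metis
  next
    case 4
    with j j' Suc.IH show ?thesis unfolding justified_def by simp metis
  next
    case 5
    with j j' Suc.IH show ?thesis unfolding justified_def by (simp split: if_splits) metis+
  next
    case 6
    \<comment> \<open>With two different minima, the program would return both zero and a successor
      at the smaller one.\<close>
    have less: False if lt: "w < w'" and jw: "justified s (derivable s) e xs w" and jw': "justified s (derivable s) e xs w'" for w w'
    proof -
      have "triple (psnd e) (cons_code w xs) 0 \<in> derivable s"
        using jw 6 by (simp add: justified_def)
      moreover obtain k where "triple (psnd e) (cons_code w xs) (Suc k) \<in> derivable s"
        using lt jw' 6 by (auto simp: justified_def)
      ultimately show False using Suc.IH by blast
    qed
    show ?thesis using less[of v v'] less[of v' v] j j' by (meson linorder_neqE_nat)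
  next
    case 7
    show ?thesis
    proof (cases "psnd e = 0")
      case True
      with j j' 7 show ?thesis by (simp add: justified_def)
    next
      case False
      with j j' 7 have v: "v \<noteq> 0" "v' \<noteq> 0"
        and "triple (pfst (psnd e - 1)) xs (pfst (v - 1)) \<in> derivable s"
          "triple (pfst (psnd e - 1)) xs (pfst (v' - 1)) \<in> derivable s"
          "triple (pair 6 (psnd (psnd e - 1))) xs (psnd (v - 1)) \<in> derivable s"
          "triple (pair 6 (psnd (psnd e - 1))) xs (psnd (v' - 1)) \<in> derivable s"
        by (simp_all add: justified_def)
      then have "pfst (v - 1) = pfst (v' - 1)" "psnd (v - 1) = psnd (v' - 1)"
        using Suc.IH by blast+
      then have "v - 1 = v' - 1" by (metis pair_pfst_psnd)
      with v show ?thesis by simp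
    qed
  qed (use j j' in \<open>simp_all add: justified_def\<close>)
qed simp

section \<open>Agreement of the stages with the evaluation relation\<close>

fun rcode :: "recf \<Rightarrow> nat" where
  "rcode Zero = pair 0 0"
| "rcode Succ = pair 1 0"
| "rcode (Proj i) = pair 2 i"
| "rcode (Comp f gs) = pair 3 (pair (rcode f) (list_encode (map rcode gs)))"
| "rcode (PrimRec g h) = pair 4 (pair (rcode g) (rcode h))"
| "rcode (Mu f) = pair 5 (rcode f)"

lemma list_encode_Cons: "list_encode (x # xs) = cons_code x (list_encode xs)"
  by (simp add: cons_code_def pair_def)

lemma cons_code_simps [simp]:
  "cons_code x xs \<noteq> 0" "pfst (cons_code x xs - 1) = x" "psnd (cons_code x xs - 1) = xs"
  "pfst (cons_code x xs - Suc 0) = x" "psnd (cons_code x xs - Suc 0) = xs"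
  by (simp_all add: cons_code_def)

lemma list_encode_eq_0_iff [simp]: "list_encode xs = 0 \<longleftrightarrow> xs = []"
  by (cases xs) auto

text \<open>This is single-valued for every number \<open>e\<close>, whether or not it is the code
  of a program, so the process may treat all natural numbers as programs.\<close>

definition derives :: "nat \<Rightarrow> nat \<Rightarrow> nat \<Rightarrow> bool" where
  "derives e xs v \<longleftrightarrow> (\<exists>s. triple e xs v \<in> derivable s)"

lemma derives_unique: "derives e xs v \<Longrightarrow> derives e xs v' \<Longrightarrow> v = v'"
  unfolding derives_def using derivable_unique derivable_mono
  by (metis (no_types) max.cobounded1 max.cobounded2 subsetD)

text \<open>The two claims need each other: a composition is evaluated through the list judgement,
  and the list judgement through its members. Hence one induction on the stage for both.\<close>

lemma derivable_sound:
  "(triple (rcode c) (list_encode xs) v \<in> derivable s \<longrightarrow> eval c xs v)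
   \<and> (triple (pair 6 (list_encode (map rcode gs))) (list_encode xs) w \<in> derivable s
      \<longrightarrow> (\<exists>ys. w = list_encode ys \<and> list_all2 (\<lambda>g y. eval g xs y) gs ys))"
proof (induction s arbitrary: c xs v gs w)
  case (Suc s)
  have IH1: "eval c xs v" if "triple (rcode c) (list_encode xs) v \<in> derivable s" for c xs v
    using Suc that by blast
  have IH2: "\<exists>ys. w = list_encode ys \<and> list_all2 (\<lambda>g y. eval g xs y) gs ys"
    if "triple (pair 6 (list_encode (map rcode gs))) (list_encode xs) w \<in> derivable s" for gs xs w
    using Suc that by blast
  have "eval c xs v" if "triple (rcode c) (list_encode xs) v \<in> derivable (Suc s)"
  proof -
    have j: "justified s (derivable s) (rcode c) (list_encode xs) v"
      using that by (auto simp: triple_def)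
    show ?thesis
    proof (cases c)
      case Zero
      with j show ?thesis by (simp add: justified_def eval_Zero)
    next
      case Succ
      with j obtain y ys where "xs = y # ys"
        by (auto simp: justified_def neq_Nil_conv)
      with j Succ show ?thesis
        by (simp add: justified_def eval_Succ list_encode_Cons del: list_encode.simps)
    next
      case (Proj i)
      with j obtain y ys where xs: "xs = y # ys"
        by (auto simp: justified_def neq_Nil_conv)
      show ?thesis
      proof (cases i)
        case 0
        with j Proj xs show ?thesis
          using eval_Proj[of 0 xs] by (simp add: justified_def list_encode_Cons del: list_encode.simps)
      next
        case (Suc i')
        then have "eval (Proj i') ys v"
          using j Proj xs IH1[of "Proj i'" ys v]
          by (simp add: justified_def list_encode_Cons del: list_encode.simps)
        then have "i' < length ys" "v = ys ! i'"
          by (auto elim: eval.cases)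
        then show ?thesis using eval_Proj[of i xs] Suc xs Proj by simp
      qed
    next
      case (Comp f gs)
      with j obtain w where w: "triple (pair 6 (list_encode (map rcode gs))) (list_encode xs) w \<in> derivable s"
        "triple (rcode f) w v \<in> derivable s"
        by (auto simp: justified_def)
      with IH2[OF w(1)] IH1 show ?thesis unfolding Comp by (auto intro: eval_Comp)
    next
      case (PrimRec g h)
      with j obtain n ys where xs: "xs = n # ys"
        by (auto simp: justified_def neq_Nil_conv)
      show ?thesis
      proof (cases n)
        case 0
        with j PrimRec xs IH1 show ?thesis
          by (simp add: justified_def list_encode_Cons eval_Prim0 del: list_encode.simps)
      next
        case (Suc n')
        with j PrimRec xs obtain y where
          "triple (rcode c) (list_encode (n' # ys)) y \<in> derivable s"
          "triple (rcode h) (list_encode (n' # y # ys)) v \<in> derivable s"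
          by (auto simp add: justified_def list_encode_Cons simp del: list_encode.simps)
        then have "eval c (n' # ys) y" "eval h (n' # y # ys) v"
          using IH1 by blast+
        with PrimRec Suc xs show ?thesis by (simp add: eval_PrimS)
      qed
    next
      case (Mu f)
      with j have "triple (rcode f) (list_encode (v # xs)) 0 \<in> derivable s"
        and "\<forall>m<v. \<exists>k. triple (rcode f) (list_encode (m # xs)) (Suc k) \<in> derivable s"
        by (auto simp add: justified_def list_encode_Cons simp del: list_encode.simps)
      with IH1 show ?thesis unfolding Mu by (intro eval_Mu) blast+
    qed
  qed
  moreover have "\<exists>ys. w = list_encode ys \<and> list_all2 (\<lambda>g y. eval g xs y) gs ys"
    if "triple (pair 6 (list_encode (map rcode gs))) (list_encode xs) w \<in> derivable (Suc s)"
  proof -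
    have j: "justified s (derivable s) (pair 6 (list_encode (map rcode gs))) (list_encode xs) w"
      using that by (auto simp: triple_def)
    show ?thesis
    proof (cases gs)
      case Nil
      with j show ?thesis by (intro exI[of _ "[]"]) (simp add: justified_def)
    next
      case (Cons g gs')
      with j have w: "w \<noteq> 0" "triple (rcode g) (list_encode xs) (pfst (w - 1)) \<in> derivable s"
        "triple (pair 6 (list_encode (map rcode gs'))) (list_encode xs) (psnd (w - 1)) \<in> derivable s"
        by (auto simp add: justified_def list_encode_Cons simp del: list_encode.simps)
      then obtain ys where "psnd (w - 1) = list_encode ys" "list_all2 (\<lambda>g y. eval g xs y) gs' ys"
        using IH2 by blast
      moreover have "w = cons_code (pfst (w - 1)) (psnd (w - 1))"
        using w(1) by (simp add: cons_code_def)
      ultimately show ?thesis using IH1[OF w(2)] Cons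
        by (intro exI[of _ "pfst (w - 1) # ys"]) (auto simp add: list_encode_Cons simp del: list_encode.simps)
    qed
  qed
  ultimately show ?case by blast
qed simp

lemma derives_Comp_list:
  "list_all2 (\<lambda>g y. derives (rcode g) xs y) gs ys
    \<Longrightarrow> derives (pair 6 (list_encode (map rcode gs))) xs (list_encode ys)"
proof (induction gs ys rule: list_all2_induct)
  case Nil
  have "justified 0 (derivable 0) (pair 6 0) xs 0" by (simp add: justified_def)
  from derivableI[OF this] show ?case by (simp add: derives_def)
next
  case (Cons g gs y ys)
  obtain s s' where s: "triple (rcode g) xs y \<in> derivable s"
     "triple (pair 6 (list_encode (map rcode gs))) xs (list_encode ys) \<in> derivable s'"
    using Cons.hyps(1) Cons.IH unfolding derives_def by blast
  have "justified (max s s') (derivable (max s s'))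
     (pair 6 (list_encode (map rcode (g # gs)))) xs (list_encode (y # ys))"
    using s derivable_mono[of s "max s s'"] derivable_mono[of s' "max s s'"]
    by (auto simp add: justified_def list_encode_Cons simp del: list_encode.simps)
  from derivableI[OF this] show ?case by (simp add: derives_def)
qed

text \<open>The components of a pair do not exceed its code. Therefore the bounds on the existential
  quantifiers in \<open>justified\<close> exclude no value that is already derivable.\<close>

lemma derivable_bound:
  assumes "triple e xs v \<in> derivable s" shows "v < s"
proof -
  have "v \<le> triple e xs v" unfolding triple_def by (meson le_pair order_trans)
  then show ?thesis using derivable_less[OF assms] by simp
qed

lemma eval_derives: "eval c xs v \<Longrightarrow> derives (rcode c) (list_encode xs) v"
proof (induction rule: eval.induct)
  case (eval_Zero xs)
  have "justified 0 (derivable 0) (rcode Zero) (list_encode xs) 0" by (simp add: justified_def)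
  from derivableI[OF this] show ?case by (simp add: derives_def)
next
  case (eval_Succ x xs)
  have "justified 0 (derivable 0) (rcode Succ) (list_encode (x # xs)) (Suc x)"
    by (simp add: justified_def list_encode_Cons del: list_encode.simps)
  from derivableI[OF this] show ?case by (simp add: derives_def)
next
  case (eval_Proj i xs)
  then show ?case
  proof (induction i arbitrary: xs)
    case 0
    then obtain y ys where "xs = y # ys" by (cases xs) auto
    then have "justified 0 (derivable 0) (rcode (Proj 0)) (list_encode xs) (xs ! 0)"
      by (simp add: justified_def list_encode_Cons del: list_encode.simps)
    from derivableI[OF this] show ?case by (simp add: derives_def)
  next
    case (Suc i)
    then obtain y ys where xs: "xs = y # ys" by (cases xs) auto
    with Suc obtain s where "triple (rcode (Proj i)) (list_encode ys) (ys ! i) \<in> derivable s"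
      unfolding derives_def by fastforce
    then have "justified s (derivable s) (rcode (Proj (Suc i))) (list_encode xs) (xs ! Suc i)"
      by (simp add: xs justified_def list_encode_Cons del: list_encode.simps)
    from derivableI[OF this] show ?case by (simp add: derives_def)
  qed
next
  case (eval_Comp xs gs ys f z)
  have "list_all2 (\<lambda>g y. derives (rcode g) (list_encode xs) y) gs ys"
    using eval_Comp(1) by (auto elim: list_all2_mono)
  from derives_Comp_list[OF this] eval_Comp.IH obtain s s' where
    s: "triple (pair 6 (list_encode (map rcode gs))) (list_encode xs) (list_encode ys) \<in> derivable s"
      "triple (rcode f) (list_encode ys) z \<in> derivable s'"
    unfolding derives_def by blast
  have "justified (max s s') (derivable (max s s')) (rcode (Comp f gs)) (list_encode xs) z"
    using s derivable_mono[of s "max s s'"] derivable_mono[of s' "max s s'"] derivable_bound[OF s(1)]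
    by (auto simp add: justified_def intro!: exI[of _ "list_encode ys"])
  from derivableI[OF this] show ?case by (simp add: derives_def)
next
  case (eval_Prim0 g xs y h)
  then obtain s where "triple (rcode g) (list_encode xs) y \<in> derivable s"
    unfolding derives_def by blast
  then have "justified s (derivable s) (rcode (PrimRec g h)) (list_encode (0 # xs)) y"
    by (simp add: justified_def list_encode_Cons del: list_encode.simps)
  from derivableI[OF this] show ?case by (simp add: derives_def)
next
  case (eval_PrimS g h n xs y z)
  then obtain s s' where
    s: "triple (rcode (PrimRec g h)) (list_encode (n # xs)) y \<in> derivable s"
      "triple (rcode h) (list_encode (n # y # xs)) z \<in> derivable s'"
    unfolding derives_def by blast
  have "justified (max s s') (derivable (max s s')) (rcode (PrimRec g h)) (list_encode (Suc n # xs)) z"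
    using s derivable_mono[of s "max s s'"] derivable_mono[of s' "max s s'"] derivable_bound[OF s(1)]
    by (auto simp add: justified_def list_encode_Cons simp del: list_encode.simps intro!: exI[of _ y])
  from derivableI[OF this] show ?case by (simp add: derives_def)
next
  case (eval_Mu f n xs)
  then obtain s where s: "triple (rcode f) (list_encode (n # xs)) 0 \<in> derivable s"
    unfolding derives_def by blast
  have "\<forall>m. \<exists>s k. m < n \<longrightarrow> triple (rcode f) (list_encode (m # xs)) (Suc k) \<in> derivable s"
    using eval_Mu unfolding derives_def by blast
  then obtain t k where t: "\<And>m. m < n \<Longrightarrow> triple (rcode f) (list_encode (m # xs)) (Suc (k m)) \<in> derivable (t m)"
    by metis
  \<comment> \<open>Minimisation has finitely many premises, one for each smaller argument, so a
    common stage for all of them exists.\<close>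
  define u where "u = Max (insert s (t ` {..<n}))"
  have u: "s \<le> u" "\<And>m. m < n \<Longrightarrow> t m \<le> u"
    by (simp_all add: u_def)
  have "k m < u \<and> triple (rcode f) (list_encode (m # xs)) (Suc (k m)) \<in> derivable u" if "m < n" for m
    using t[OF that] derivable_mono[OF u(2)[OF that]] derivable_bound[OF t[OF that]] u(2)[OF that] by auto
  then have "justified u (derivable u) (rcode (Mu f)) (list_encode xs) n"
    using s derivable_mono[OF u(1)]
    by (auto simp add: justified_def list_encode_Cons simp del: list_encode.simps)
  from derivableI[OF this] show ?case by (simp add: derives_def)
qed

lemma eval_iff_derives: "eval c xs v \<longleftrightarrow> derives (rcode c) (list_encode xs) v"
  using eval_derives derivable_sound unfolding derives_def by blast

lemma eval_det: "eval c xs v \<Longrightarrow> eval c xs v' \<Longrightarrow> v = v'"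
  unfolding eval_iff_derives by (rule derives_unique)

lemma recfn_eval:
  assumes "recfn n F" obtains c where "\<And>xs v. length xs = n \<Longrightarrow> eval c xs v \<longleftrightarrow> v = F xs"
  using assms eval_det unfolding recfn_def by metis

text \<open>Unbounded search followed by computable post-processing. Halting exactly when a witness
  exists yields the recursive enumerability of the operation as well as the partial selection
  rules.\<close>

lemma search_program:
  assumes "decidable (\<lambda>u. D (pfst u) (psnd u))" "computable g"
  obtains d where
    "\<And>x v. eval d [x] v \<longleftrightarrow> (\<exists>p. D x p) \<and> v = g (pair x (LEAST p. D x p))"
proof -
  have pair: "recfn 2 (\<lambda>xs. pair (xs ! i) (xs ! j))" if "i < 2" "j < 2" for i j
    using that by (intro recfn_pair recfn_proj)
  \<comment> \<open>\<open>Mu\<close> looks for a zero, so the indicator is inverted.\<close>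
  have "computable (\<lambda>u. 1 - of_bool (D (pfst u) (psnd u)))"
    by (intro computable_diff computable_const computable_of_bool assms)
  from recfn_computable[OF this pair[of 1 0]]
  have "recfn 2 (\<lambda>xs. 1 - of_bool (D (xs ! 1) (xs ! 0)))" by simp
  then obtain c where c: "\<And>xs v. length xs = 2 \<Longrightarrow>
      eval c xs v \<longleftrightarrow> v = 1 - of_bool (D (xs ! 1) (xs ! 0))"
    by (rule recfn_eval) blast
  have Mu: "eval (Mu c) [x] p \<longleftrightarrow> (\<exists>p. D x p) \<and> p = (LEAST p. D x p)" for x p
  proof -
    have "eval (Mu c) [x] p \<longleftrightarrow> eval c [p, x] 0 \<and> (\<forall>m<p. \<exists>k. eval c [m, x] (Suc k))"
      by (auto elim: eval.cases intro: eval.eval_Mu)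
    also have "\<dots> \<longleftrightarrow> D x p \<and> (\<forall>m<p. \<not> D x m)"
      by (auto simp: c)
    also have "\<dots> \<longleftrightarrow> (\<exists>p. D x p) \<and> p = (LEAST p. D x p)"
      by (metis LeastI Least_equality not_less not_less_Least)
    finally show ?thesis .
  qed
  have "recfn 2 (\<lambda>xs. g (pair (xs ! 0) (xs ! 1)))"
    by (rule recfn_computable[OF assms(2) pair]) simp_all
  then obtain e where e: "\<And>xs v. length xs = 2 \<Longrightarrow> eval e xs v \<longleftrightarrow> v = g (pair (xs ! 0) (xs ! 1))"
    by (rule recfn_eval) blast
  define d where "d = Comp e [Proj 0, Mu c]"
  have "eval d [x] v \<longleftrightarrow> (\<exists>p. D x p) \<and> v = g (pair x (LEAST p. D x p))" for x v
  proof
    assume "eval d [x] v"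
    then obtain ys where "list_all2 (\<lambda>h y. eval h [x] y) [Proj 0, Mu c] ys" "eval e ys v"
      unfolding d_def by (auto elim: eval.cases)
    then obtain a p where ap: "eval (Proj 0) [x] a" "eval (Mu c) [x] p" "eval e [a, p] v"
      by (auto simp: list_all2_Cons1)
    from ap(1) have "a = x" by (auto elim: eval.cases)
    with ap show "(\<exists>p. D x p) \<and> v = g (pair x (LEAST p. D x p))"
      by (simp add: Mu e)
  next
    assume a: "(\<exists>p. D x p) \<and> v = g (pair x (LEAST p. D x p))"
    show "eval d [x] v"
      unfolding d_def
    proof (rule eval_Comp)
      show "list_all2 (\<lambda>h y. eval h [x] y) [Proj 0, Mu c] [x, LEAST p. D x p]"
        using a eval_Proj[of 0 "[x]"] by (simp add: Mu)
    qed (use a in \<open>simp add: e\<close>)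
  qed
  then show ?thesis by (rule that)
qed

section \<open>The stages as computable numbers\<close>

lemma set_decode_derivable: "t \<in> derivable s \<longleftrightarrow> odd (set_encode (derivable s) div 2 ^ t)"
  using set_encode_inverse[OF finite_derivable, of s] unfolding set_decode_def by blast

text \<open>The stage as a bit mask: bit \<open>t\<close> is set when the triple \<open>t\<close>
  belongs to it. The recursion over finite sets becomes a primitive recursion on numbers.\<close>

definition derivable_code :: "nat \<Rightarrow> nat" where
  "derivable_code s = rec_nat 0 (\<lambda>k r. \<Sum>t<k. of_bool (justified k (set_decode r)
     (pfst t) (pfst (psnd t)) (psnd (psnd t))) * 2 ^ t) s"

lemma derivable_code: "derivable_code s = set_encode (derivable s)"
proof (induction s)
  case (Suc s)
  have eq: "derivable (Suc s) = {t \<in> {..<s}. justified s (derivable s) (pfst t) (pfst (psnd t)) (psnd (psnd t))}"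
    by auto
  have sum: "(\<Sum>t<s. of_bool (Q t) * 2 ^ t) = set_encode {t \<in> {..<s}. Q t}" for Q
    unfolding set_encode_def by (subst sum.inter_filter, simp, rule sum.cong) simp_all
  have "derivable_code (Suc s) = (\<Sum>t<s. of_bool (justified s (set_decode (derivable_code s))
     (pfst t) (pfst (psnd t)) (psnd (psnd t))) * 2 ^ t)"
    by (simp add: derivable_code_def)
  then show ?case
    unfolding Suc set_encode_inverse[OF finite_derivable] sum eq .
qed (simp add: derivable_code_def)

lemma computable_derivable_code:
  assumes "computable a" shows "computable (\<lambda>x. derivable_code (a x))"
  unfolding derivable_code_def justified_def set_decode_def mem_Collect_eq triple_def cons_code_def if_bool_eq_conj
  by (intro computable_rec comp_intros assms)

lemma decidable_derivable:
  assumes "computable a" "computable b" shows "decidable (\<lambda>x. a x \<in> derivable (b x))"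
  unfolding set_decode_derivable derivable_code[symmetric]
  by (intro comp_intros computable_derivable_code assms)

section \<open>Averages over random strings\<close>

text \<open>The expectation over uniformly distributed strings of length \<open>n\<close>.
  Conditioning on a prefix becomes \<open>avg_append\<close>, so that most probabilistic estimates
  reduce to finite inductions.\<close>

primrec avg :: "nat \<Rightarrow> (bool list \<Rightarrow> real) \<Rightarrow> real" where
  "avg 0 g = g []"
| "avg (Suc n) g = (avg n (\<lambda>y. g (True # y)) + avg n (\<lambda>y. g (False # y))) / 2"

lemma avg_append: "avg (m + n) g = avg m (\<lambda>x. avg n (\<lambda>y. g (x @ y)))"
  by (induction m arbitrary: g) auto

lemma avg_const [simp]: "avg n (\<lambda>_. c) = c"
  by (induction n) auto

lemma avg_add: "avg n (\<lambda>x. f x + g x) = avg n f + avg n g"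
  by (induction n arbitrary: f g) (auto simp: field_simps)

lemma avg_cmult: "avg n (\<lambda>x. c * f x) = c * avg n f"
  by (induction n arbitrary: f) (auto simp: field_simps)

lemma avg_mono:
  "(\<And>y. length y = n \<Longrightarrow> f y \<le> g y) \<Longrightarrow> avg n f \<le> avg n g"
proof (induction n arbitrary: f g)
  case (Suc n)
  from Suc.IH[of "\<lambda>y. f (True # y)" "\<lambda>y. g (True # y)"]
    Suc.IH[of "\<lambda>y. f (False # y)" "\<lambda>y. g (False # y)"] Suc.prems
  show ?case by auto
qed simp

lemma avg_cong:
  "(\<And>y. length y = n \<Longrightarrow> f y = g y) \<Longrightarrow> avg n f = avg n g"
  by (intro antisym avg_mono) auto

lemma avg_all: "avg n (\<lambda>y. of_bool (\<forall>b\<in>set y. b)) = (1 / 2) ^ n"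
proof (induction n)
  case (Suc n)
  have "of_bool (\<forall>b\<in>set (False # y). b) = (0::real)" for y by simp
  with Suc show ?case by (simp del: set_simps add: list.set)
qed simp

section \<open>Events that depend on a finite prefix\<close>

lemma length_pref [simp]: "length (pref w n) = n"
  by (simp add: pref_def)

lemma take_pref [simp]: "take m (pref w n) = pref w (min m n)"
  by (rule nth_equalityI) (auto simp: pref_def)

lemma nth_pref [simp]: "i < n \<Longrightarrow> pref w n ! i = w i"
  by (simp add: pref_def)

lemma pref_snoc: "pref w (Suc n) = pref w n @ [w n]"
  by (simp add: pref_def)

lemma avg_snoc: "avg (Suc n) g = avg n (\<lambda>x. (g (x @ [True]) + g (x @ [False])) / 2)"
  using avg_append[of n 1 g] by simp

interpretation L: prob_space L
  unfolding L_def by (intro prob_space_PiM measure_pmf.prob_space_axioms)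

lemma space_L [simp]: "space L = UNIV"
  by (simp add: L_def space_PiM)

lemma measure_cylinder: "measure L {\<alpha>. pref \<alpha> n = x} = of_bool (length x = n) / 2 ^ n"
  and sets_cylinder: "{\<alpha>. pref \<alpha> n = x} \<in> sets L"
proof -
  interpret P: product_prob_space "\<lambda>_::nat. measure_pmf (bernoulli_pmf (1 / 2))" UNIV
    by unfold_locales
  have empty: "{\<alpha>. pref \<alpha> n = x} = {}" if "length x \<noteq> n"
    using that by auto
  have eq: "{\<alpha>. pref \<alpha> n = x} = {\<alpha> \<in> space L. \<forall>i\<in>{..<n}. \<alpha> i \<in> {x ! i}}" if "length x = n"
    using that by (auto simp: list_eq_iff_nth_eq)
  have s: "{\<alpha> \<in> space L. \<forall>i\<in>{..<n}. \<alpha> i \<in> {x ! i}} \<in> sets L"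
  proof -
    have [measurable]: "(\<lambda>\<alpha>. \<alpha> i) \<in> L \<rightarrow>\<^sub>M count_space UNIV" for i
    proof -
      have "(\<lambda>\<alpha>. \<alpha> i) \<in> L \<rightarrow>\<^sub>M measure_pmf (bernoulli_pmf (1 / 2))"
        unfolding L_def by (rule measurable_component_singleton) simp
      then show ?thesis by simp
    qed
    show ?thesis by measurable
  qed
  show "{\<alpha>. pref \<alpha> n = x} \<in> sets L"
    using s empty eq by (cases "length x = n") auto
  show "measure L {\<alpha>. pref \<alpha> n = x} = of_bool (length x = n) / 2 ^ n"
  proof (cases "length x = n")
    case True
    have "emeasure L {\<alpha> \<in> space L. \<forall>i\<in>{..<n}. \<alpha> i \<in> {x ! i}}
       = (\<Prod>i<n. emeasure (measure_pmf (bernoulli_pmf (1 / 2))) {x ! i})"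
      unfolding L_def by (rule P.emeasure_PiM_Collect) auto
    also have "\<dots> = (\<Prod>i<n. ennreal (1 / 2))"
    proof (rule prod.cong)
      fix i
      show "emeasure (measure_pmf (bernoulli_pmf (1 / 2))) {x ! i} = ennreal (1 / 2)"
        by (cases "x ! i") (simp_all add: emeasure_pmf_single)
    qed simp
    also have "\<dots> = ennreal ((1 / 2) ^ n)"
      unfolding prod_constant by (subst ennreal_power) simp_all
    finally have "measure L {\<alpha> \<in> space L. \<forall>i\<in>{..<n}. \<alpha> i \<in> {x ! i}} = (1 / 2) ^ n"
      unfolding measure_def by (simp add: enn2real_ennreal)
    then show ?thesis using eq[OF True] True by (simp add: power_divide)
  qed (simp add: empty)
qed

lemma sets_pref [measurable]: "{\<alpha>. Q (pref \<alpha> n)} \<in> sets L"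
proof -
  have "{\<alpha>. Q (pref \<alpha> n)} = (\<Union>x\<in>{x. Q x}. {\<alpha>. pref \<alpha> n = x})" by auto
  moreover have "\<dots> \<in> sets L"
    by (rule sets.countable_UN') (auto simp: sets_cylinder)
  ultimately show ?thesis by simp
qed

text \<open>The bridge from the measure \<open>L\<close> to finite averages, by splitting off the
  last bit.\<close>

lemma measure_pref: "measure L {\<alpha>. Q (pref \<alpha> n)} = avg n (\<lambda>x. of_bool (Q x))"
proof -
  have "measure L {\<alpha>. pref \<alpha> n \<in> {x. Q x}} = avg n (\<lambda>x. of_bool (Q x))"
  proof (induction n arbitrary: Q)
    case 0
    show ?case using L.prob_space by (cases "Q []") (simp_all add: pref_def)
  next
    case (Suc n)
    \<comment> \<open>The next bit is independent of the prefix. The measures of the cylinders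
      suffice, since the event is a finite disjoint union of them.\<close>
    have half: "measure L {\<alpha>. Q (pref \<alpha> n) \<and> \<alpha> n = b} = measure L {\<alpha>. Q (pref \<alpha> n)} / 2" for Q b
    proof -
      define X where "X = {x. length x = n \<and> Q x}"
      have fin: "finite X"
        by (rule finite_subset[OF _ finite_lists_length_eq[of "UNIV :: bool set" n]]) (auto simp: X_def)
      have "measure L {\<alpha>. Q (pref \<alpha> n) \<and> \<alpha> n = b}
          = measure L (\<Union>x\<in>X. {\<alpha>. pref \<alpha> (Suc n) = x @ [b]})"
        by (intro arg_cong[where f = "measure L"]) (auto simp: X_def pref_snoc)
      also have "\<dots> = (\<Sum>x\<in>X. measure L {\<alpha>. pref \<alpha> (Suc n) = x @ [b]})"
        using sets_cylinder fin
        by (intro L.finite_measure_finite_Union) (auto simp: disjoint_family_on_def)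
      also have "\<dots> = (\<Sum>x\<in>X. measure L {\<alpha>. pref \<alpha> n = x}) / 2"
        unfolding measure_cylinder sum_divide_distrib by (intro sum.cong) (auto simp: X_def)
      also have "(\<Sum>x\<in>X. measure L {\<alpha>. pref \<alpha> n = x}) = measure L (\<Union>x\<in>X. {\<alpha>. pref \<alpha> n = x})"
        using sets_cylinder fin
        by (intro L.finite_measure_finite_Union[symmetric]) (auto simp: disjoint_family_on_def)
      also have "(\<Union>x\<in>X. {\<alpha>. pref \<alpha> n = x}) = {\<alpha>. Q (pref \<alpha> n)}"
        by (auto simp: X_def)
      finally show ?thesis .
    qed
    have sets: "{\<alpha>. Q (pref \<alpha> n) \<and> \<alpha> n = b} \<in> sets L" for Q b
    proof -
      have "{\<alpha>. Q (pref \<alpha> n) \<and> \<alpha> n = b} = (\<Union>x\<in>{x. Q x}. {\<alpha>. pref \<alpha> (Suc n) = x @ [b]})"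
        by (auto simp: pref_snoc)
      moreover have "\<dots> \<in> sets L"
        by (rule sets.countable_UN') (auto simp: sets_cylinder)
      ultimately show ?thesis by simp
    qed
    have "measure L {\<alpha>. Q (pref \<alpha> (Suc n))}
        = measure L ({\<alpha>. Q (pref \<alpha> n @ [True]) \<and> \<alpha> n = True} \<union> {\<alpha>. Q (pref \<alpha> n @ [False]) \<and> \<alpha> n = False})"
      by (intro arg_cong[where f = "measure L"] set_eqI) (simp add: pref_snoc, metis (full_types))
    also have "\<dots> = measure L {\<alpha>. Q (pref \<alpha> n @ [True]) \<and> \<alpha> n = True}
        + measure L {\<alpha>. Q (pref \<alpha> n @ [False]) \<and> \<alpha> n = False}"
      by (intro L.finite_measure_Union sets sets[where Q = "\<lambda>x. Q (x @ [True])"]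
          sets[where Q = "\<lambda>x. Q (x @ [False])"]) auto
    also have "\<dots> = (measure L {\<alpha>. Q (pref \<alpha> n @ [True])} + measure L {\<alpha>. Q (pref \<alpha> n @ [False])}) / 2"
      using half[of "\<lambda>x. Q (x @ [True])" True] half[of "\<lambda>x. Q (x @ [False])" False] by simp
    also have "\<dots> = (avg n (\<lambda>x. of_bool (Q (x @ [True]))) + avg n (\<lambda>x. of_bool (Q (x @ [False])))) / 2"
      using Suc[of "\<lambda>x. Q (x @ [True])"] Suc[of "\<lambda>x. Q (x @ [False])"] by simp
    also have "\<dots> = avg (Suc n) (\<lambda>x. of_bool (Q x))"
      unfolding avg_snoc using avg_cmult[of n "1/2" "\<lambda>x. of_bool (Q (x @ [True])) + of_bool (Q (x @ [False]))"]
      by (simp add: avg_add)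
    finally show ?case by simp
  qed
  then show ?thesis by simp
qed

text \<open>The forecast \<open>h\<close> sees only the past while the next bit is fair, so the two
  possible losses \<open>m - h\<close> and \<open>h\<close> average to \<open>m / 2\<close> at each
  position, whatever the strategy.\<close>

lemma avg_loss:
  fixes h :: "bool list \<Rightarrow> real"
  shows "avg n (\<lambda>x. \<Sum>i<n. if x ! i then m - h (take i x) else h (take i x)) = n * (m / 2)"
proof (induction n)
  case (Suc n)
  let ?S = "\<lambda>n x. \<Sum>i<n. if x ! i then m - h (take i x) else h (take i x)"
  have snoc: "?S (Suc n) (x @ [b]) = ?S n x + (if b then m - h x else h x)" if "length x = n" for x b
    using that by (auto intro!: sum.cong simp: nth_append)
  have "avg (Suc n) (?S (Suc n)) = avg n (\<lambda>x. ?S n x + m / 2)"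
    unfolding avg_snoc by (intro avg_cong) (simp only: snoc, simp add: field_simps)
  also have "\<dots> = n * (m / 2) + m / 2"
    unfolding avg_add Suc by simp
  finally show ?case by (simp add: field_simps)
qed simp

text \<open>Markov's inequality for the nonnegative quantity \<open>m * n\<close> minus the total
  loss: its mean is \<open>m * n / 2\<close>, and it is at least two thirds of \<open>m * n\<close>
  on the event, so the probability is at most (1/2) / (2/3) = 3/4.\<close>

lemma avg_loss_small:
  fixes h :: "bool list \<Rightarrow> real"
  assumes h: "\<And>x. 0 \<le> h x" "\<And>x. h x \<le> m" and m: "m > 0" "n > 0"
  shows "avg n (\<lambda>x. of_bool (3 * (\<Sum>i<n. if x ! i then m - h (take i x) else h (take i x)) \<le> m * n)) \<le> 3 / 4"
proof -
  let ?S = "\<lambda>x. \<Sum>i<n. if x ! i then m - h (take i x) else h (take i x)"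
  have "avg n (\<lambda>x. (2 / 3 * (m * n)) * of_bool (3 * ?S x \<le> m * n)) \<le> avg n (\<lambda>x. m * n + (-1) * ?S x)"
  proof (rule avg_mono)
    fix x
    have "?S x \<le> (\<Sum>i<n. m)"
    proof (rule sum_mono)
      fix i
      show "(if x ! i then m - h (take i x) else h (take i x)) \<le> m" using h[of "take i x"] by simp
    qed
    then show "(2 / 3 * (m * n)) * of_bool (3 * ?S x \<le> m * n) \<le> m * n + (-1) * ?S x"
      by (auto simp: algebra_simps)
  qed
  also have "\<dots> = m * n / 2"
    unfolding avg_add avg_cmult avg_loss by simp
  finally have "(2 / 3 * (m * n)) * avg n (\<lambda>x. of_bool (3 * ?S x \<le> m * n)) \<le> (2 / 3 * (m * n)) * (3 / 4)"
    unfolding avg_cmult by simp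
  moreover have "2 / 3 * (m * n) > 0" using m by simp
  ultimately show ?thesis using mult_le_cancel_left_pos by blast
qed

section \<open>Computations on binary strings\<close>

lemma list_code_inject [simp]: "list_code x = list_code y \<longleftrightarrow> x = y"
proof (induction x arbitrary: y)
  case Nil
  then show ?case by (cases y) auto
next
  case (Cons b x)
  then show ?case
  proof (cases y)
    case (Cons c y')
    have "2 * list_code x + (if b then 2 else 1) = 2 * list_code y' + (if c then 2 else 1)
      \<longleftrightarrow> list_code x = list_code y' \<and> b = c"
      by (cases b; cases c) presburger+
    then show ?thesis using Cons.IH[of y'] Cons by auto
  qed auto
qed

lemma list_code_surj: "\<exists>x. list_code x = n"
proof (induction n rule: less_induct)
  case (less n)
  show ?case
  proof (cases "n = 0")
    case True
    then show ?thesis by (intro exI[of _ "[]"]) simp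
  next
    case False
    then have "(n - 1) div 2 < n" by presburger
    then obtain x where "list_code x = (n - 1) div 2" using less by blast
    with False have "list_code (even n # x) = n"
      by (cases "even n") (auto elim!: evenE oddE)
    then show ?thesis ..
  qed
qed

definition string_of :: "nat \<Rightarrow> bool list" where
  "string_of n = (SOME x. list_code x = n)"

lemma list_code_string_of [simp]: "list_code (string_of n) = n"
  unfolding string_of_def by (rule someI_ex[OF list_code_surj])

lemma string_of_code [simp]: "string_of (list_code x) = x"
  using list_code_string_of[of "list_code x"] by (simp only: list_code_inject)

text \<open>A total version of list access, false beyond the end, so that it can be decided without
  side conditions.\<close>

definition nth_bit :: "bool list \<Rightarrow> nat \<Rightarrow> bool" where
  "nth_bit x i \<longleftrightarrow> i < length x \<and> x ! i"

abbreviation computable_list :: "(nat \<Rightarrow> bool list) \<Rightarrow> bool" where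
  "computable_list l \<equiv> computable (\<lambda>x. list_code (l x))"

lemma computable_decode: "computable a \<Longrightarrow> computable_list (\<lambda>x. string_of (a x))"
  by simp

lemma list_code_tl: "list_code (tl x) = (list_code x - 1) div 2"
  by (cases x) auto

lemma computable_drop:
  assumes "computable i" "computable_list l" shows "computable_list (\<lambda>x. drop (i x) (l x))"
proof -
  have "computable (\<lambda>x. rec_nat (list_code (l x)) (\<lambda>k r. (r - 1) div 2) (i x))"
    by (intro computable_rec comp_intros assms)
  moreover have "rec_nat (list_code x) (\<lambda>k r. (r - 1) div 2) n = list_code (drop n x)" for x n
    by (induction n) (simp_all add: list_code_tl drop_Suc drop_tl)
  ultimately show ?thesis by simp
qed

lemma list_code_eq_0 [simp]: "list_code x = 0 \<longleftrightarrow> x = []"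
  by (cases x) auto

lemma decidable_nth_bit:
  assumes "computable i" "computable_list l" shows "decidable (\<lambda>x. nth_bit (l x) (i x))"
proof -
  \<comment> \<open>The digit for \<open>True\<close> is 2 and that for \<open>False\<close> is 1: a
    nonzero even code belongs to a string that starts with \<open>True\<close>.\<close>
  have "decidable (\<lambda>x. list_code (drop (i x) (l x)) \<noteq> 0 \<and> even (list_code (drop (i x) (l x))))"
    by (intro comp_intros computable_drop assms)
  moreover have "list_code (drop n x) \<noteq> 0 \<and> even (list_code (drop n x)) \<longleftrightarrow> nth_bit x n" for n x
    by (cases "n < length x") (auto simp: nth_bit_def Cons_nth_drop_Suc[symmetric])
  ultimately show ?thesis by simp
qed

lemma length_le_list_code: "length x \<le> list_code x"
  by (induction x) auto

lemma computable_length: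
  assumes "computable_list l" shows "computable (\<lambda>x. length (l x))"
proof -
  \<comment> \<open>The length counts the nonempty suffixes; the code is a computable bound for
    it.\<close>
  have "computable (\<lambda>x. \<Sum>i<list_code (l x). of_bool (list_code (drop i (l x)) \<noteq> 0))"
    by (intro comp_intros computable_drop assms computable_comp[OF assms])
  moreover have "(\<Sum>i<list_code x. of_bool (list_code (drop i x) \<noteq> 0)) = length x" for x
  proof -
    have "{i. i < list_code x \<and> i < length x} = {..<length x}"
      using length_le_list_code[of x] by auto
    then show ?thesis by (simp add: not_le Int_def)
  qed
  ultimately show ?thesis by simp
qed

text \<open>\<open>list_code\<close> is bijective binary notation with digits 1 and 2, least
  significant digit first, so appending is a shifted addition.\<close>

lemma list_code_append: "list_code (x @ y) = list_code x + 2 ^ length x * list_code y"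
  by (induction x) auto

lemma computable_append:
  assumes "computable_list l" "computable_list m" shows "computable_list (\<lambda>x. l x @ m x)"
  unfolding list_code_append by (intro comp_intros computable_length assms)

lemma computable_take:
  assumes "computable i" "computable_list l" shows "computable_list (\<lambda>x. take (i x) (l x))"
proof -
  have "computable (\<lambda>x. list_code (l x) - 2 ^ i x * list_code (drop (i x) (l x)))"
    by (intro comp_intros computable_drop assms)
  moreover have "list_code x - 2 ^ n * list_code (drop n x) = list_code (take n x)" for n x
  proof (cases "n \<le> length x")
    case True
    have "list_code x = list_code (take n x) + 2 ^ length (take n x) * list_code (drop n x)"
      by (subst list_code_append[symmetric]) simp
    with True show ?thesis by (simp add: min_absorb2)
  qed simp
  ultimately show ?thesis by simp
qed

lemma decidable_list_eq:
  assumes "computable_list l" "computable_list m" shows "decidable (\<lambda>x. l x = m x)"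
  using decidable_eq[OF assms] by simp

lemma prefix_iff_take: "prefix x y \<longleftrightarrow> take (length x) y = x"
  by (metis append_eq_conv_conj prefix_def take_is_prefix)

lemma decidable_prefix:
  assumes "computable_list l" "computable_list m" shows "decidable (\<lambda>x. prefix (l x) (m x))"
  unfolding prefix_iff_take by (intro decidable_list_eq computable_take computable_length assms)

lemma computable_list_if:
  assumes "decidable P" "computable_list l" "computable_list m"
  shows "computable_list (\<lambda>x. if P x then l x else m x)"
  using computable_if[OF assms] by (simp add: if_distrib)

lemma computable_list_rec:
  assumes "computable_list a" "computable m"
    "computable_list (\<lambda>p. g (pfst p) (string_of (pfst (psnd p))) (psnd (psnd p)))"
  shows "computable_list (\<lambda>x. rec_nat (a x) (\<lambda>k r. g k r x) (m x))"
proof -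
  have "computable (\<lambda>x. rec_nat (list_code (a x)) (\<lambda>k r. list_code (g k (string_of r) x)) (m x))"
    by (rule computable_rec[OF assms(1,2)]) (rule assms(3))
  moreover have "rec_nat (list_code b) (\<lambda>k r. list_code (g k (string_of r) x)) n
      = list_code (rec_nat b (\<lambda>k r. g k r x) n)" for b x n
    by (induction n) simp_all
  ultimately show ?thesis by simp
qed

lemmas list_intros = computable_decode computable_drop decidable_nth_bit computable_length
  computable_append computable_take decidable_list_eq decidable_prefix computable_list_if

text \<open>Forecasts are queried with precision 1/100 and rounded to multiples of 1/100.\<close>

definition precision :: nat where
  "precision = pair (int_encode 1) 99"

lemma rat_decode_precision [simp]: "rat_decode precision = 1 / 100"
  by (simp add: rat_decode_def precision_def pair_def)

text \<open>The coded rational times 100, rounded down and clipped to the interval from 0 to 100.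
  Odd numerator codes stand for negative integers, even ones for their halves, so natural number
  arithmetic is enough.\<close>

definition level :: "nat \<Rightarrow> nat" where
  "level v = (if odd (pfst v) then 0 else
     if 100 < 100 * (pfst v div 2) div Suc (psnd v) then 100 else 100 * (pfst v div 2) div Suc (psnd v))"

lemma level_le: "level v \<le> 100"
  by (auto simp: level_def)

text \<open>The error 1/50 is 1/100 from the precision of the answer and 1/100 from rounding.
  Clipping does no harm because \<open>r\<close> lies in the unit interval.\<close>

lemma level_approx:
  assumes "\<bar>rat_decode v - r\<bar> \<le> 1 / 100" "0 \<le> r" "r \<le> 1"
  shows "\<bar>real (level v) / 100 - r\<bar> \<le> 1 / 50"
proof (cases "odd (pfst v)")
  case True
  then have "rat_decode v = (- 1 - real (pfst v div 2)) / real (Suc (psnd v))"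
    by (simp add: rat_decode_def case_prod_unfold pfst_def psnd_def int_decode_def sum_decode_def)
  then have "rat_decode v \<le> 0"
    by (simp add: divide_le_0_iff)
  with assms True show ?thesis by (simp add: level_def)
next
  case False
  define A where "A = pfst v div 2"
  define B where "B = Suc (psnd v)"
  have q: "rat_decode v = real A / real B"
    using False
    by (simp add: rat_decode_def case_prod_unfold pfst_def psnd_def int_decode_def sum_decode_def A_def B_def)
  define F where "F = 100 * A div B"
  have le: "real F \<le> 100 * (real A / real B)"
    using of_nat_div_le_of_nat[of "100 * A" B, where 'a = real] by (simp add: F_def)
  have less: "100 * (real A / real B) < real F + 1"
  proof -
    have "100 * A < B + F * B"
      unfolding F_def by (rule dividend_less_div_times) (simp add: B_def)
    then have "100 * real A < real B + real F * real B"
      by (simp only: of_nat_less_iff[symmetric, where 'a = real] of_nat_add of_nat_mult of_nat_numeral)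
    then show ?thesis by (simp add: B_def field_simps)
  qed
  have level: "level v = (if 100 < F then 100 else F)"
    using False by (simp add: level_def A_def B_def F_def)
  have r: "real A / real B - r \<le> 1 / 100" "r - real A / real B \<le> 1 / 100"
    using assms(1) unfolding q by linarith+
  show ?thesis
  proof (cases "100 < F")
    case True
    then have "real F > 100" "real (level v) = 100" using level by simp_all
    with r le less assms(2,3) show ?thesis unfolding abs_le_iff by linarith
  next
    case False
    then have "real (level v) = real F" using level by simp
    with r le less assms(2,3) show ?thesis unfolding abs_le_iff by linarith
  qed
qed

lemma computable_level: "computable a \<Longrightarrow> computable (\<lambda>x. level (a x))"
  unfolding level_def by (intro comp_intros)

section \<open>Programs queried up to a stage\<close>

definition query :: "bool list \<Rightarrow> nat" where
  "query x = list_encode [pair (list_code x) precision]"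

definition answers :: "nat \<Rightarrow> nat \<Rightarrow> bool list \<Rightarrow> nat \<Rightarrow> bool" where
  "answers s e x v \<longleftrightarrow> triple e (query x) v \<in> derivable s"

definition halts :: "nat \<Rightarrow> nat \<Rightarrow> bool list \<Rightarrow> bool" where
  "halts s e x \<longleftrightarrow> (\<exists>v<s. answers s e x v)"

text \<open>At most one summand is present by \<open>derivable_unique\<close>: a computable
  substitute for a definite description.\<close>

definition answer_level :: "nat \<Rightarrow> nat \<Rightarrow> bool list \<Rightarrow> nat" where
  "answer_level s e x = (\<Sum>v<s. of_bool (answers s e x v) * level v)"

text \<open>Only the single precision 1/100 is asked. Halting there can be confirmed at a finite
  stage, whereas a forecast is defined only if the algorithm halts at every precision.\<close>

definition defined :: "nat \<Rightarrow> bool list \<Rightarrow> bool" where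
  "defined e x \<longleftrightarrow> (\<exists>s. halts s e x)"

definition forecast_level :: "nat \<Rightarrow> bool list \<Rightarrow> nat" where
  "forecast_level e x = level (THE v. derives e (query x) v)"

lemma halts_mono: "halts s e x \<Longrightarrow> s \<le> s' \<Longrightarrow> halts s' e x"
  unfolding halts_def answers_def using derivable_mono by (meson less_le_trans subsetD)

lemma halts_iff: "halts s e x \<longleftrightarrow> (\<exists>v. answers s e x v)"
  unfolding halts_def answers_def using derivable_bound by blast

lemma defined_iff: "defined e x \<longleftrightarrow> (\<exists>v. derives e (query x) v)"
  unfolding defined_def halts_iff answers_def derives_def by blast

lemma forecast_level_eq: "derives e (query x) v \<Longrightarrow> forecast_level e x = level v"
  unfolding forecast_level_def using derives_unique by (metis the_equality)

lemma answer_level_eq: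
  assumes "halts s e x" shows "answer_level s e x = forecast_level e x"
proof -
  obtain v where v: "v < s" "answers s e x v" using assms by (auto simp: halts_def)
  have "answers s e x u \<longleftrightarrow> u = v" for u
    using v derivable_unique unfolding answers_def by blast
  then have "answer_level s e x = (\<Sum>u<s. of_bool (u = v) * level u)"
    by (simp add: answer_level_def)
  also have "\<dots> = level v" using v(1) by (simp add: of_bool_def if_distrib[of "\<lambda>c. c * _"] sum.delta cong: if_cong)
  also have "\<dots> = forecast_level e x"
    using v(2) by (intro forecast_level_eq[symmetric]) (auto simp: answers_def derives_def)
  finally show ?thesis .
qed

lemma forecast_level_le: "forecast_level e x \<le> 100"
  by (simp add: forecast_level_def level_le)

lemma decidable_answers:
  assumes "computable s" "computable e" "computable_list l" "computable v"
  shows "decidable (\<lambda>x. answers (s x) (e x) (l x) (v x))"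
  unfolding answers_def query_def triple_def list_encode.simps pair_def[symmetric]
  by (intro comp_intros decidable_derivable assms)

lemma decidable_halts:
  assumes "computable s" "computable e" "computable_list l"
  shows "decidable (\<lambda>x. halts (s x) (e x) (l x))"
  unfolding halts_def
  by (intro comp_intros decidable_answers computable_comp[OF assms(1)] computable_comp[OF assms(2)]
      computable_comp[OF assms(3)] assms)

lemma computable_answer_level:
  assumes "computable s" "computable e" "computable_list l"
  shows "computable (\<lambda>x. answer_level (s x) (e x) (l x))"
  unfolding answer_level_def
  by (intro comp_intros computable_level decidable_answers computable_comp[OF assms(1)]
      computable_comp[OF assms(2)] computable_comp[OF assms(3)] assms)

section \<open>The random process\<close>

text \<open>The positions where the blocks begin. The factor \<open>Suc k\<close> makes the past a
  vanishing fraction of the sequence at the end of block \<open>k\<close>; the inner successor gets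
  the growth started from 0.\<close>

definition bnd :: "nat \<Rightarrow> nat" where
  "bnd n = rec_nat 0 (\<lambda>k r. Suc k * Suc r) n"

definition blen :: "nat \<Rightarrow> nat" where
  "blen k = bnd (Suc k) - bnd k"

text \<open>Each number is the first component of infinitely many pairs, so each program owns
  infinitely many blocks.\<close>

definition task :: "nat \<Rightarrow> nat" where
  "task k = pfst k"

lemma bnd_simps [simp]: "bnd 0 = 0" "bnd (Suc k) = Suc k * Suc (bnd k)"
  by (simp_all add: bnd_def)

declare bnd_simps(2) [simp del]

lemma bnd_less_Suc: "bnd k < bnd (Suc k)"
  by (simp add: bnd_simps)

lemma bnd_Suc_eq: "bnd (Suc k) = bnd k + blen k"
  using bnd_less_Suc[of k] by (simp add: blen_def)

lemma blen_pos: "0 < blen k"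
  using bnd_less_Suc[of k] by (simp add: blen_def)

lemma bnd_mono: "j \<le> k \<Longrightarrow> bnd j \<le> bnd k"
  by (rule lift_Suc_mono_le[of bnd]) (simp_all add: less_imp_le bnd_less_Suc)

lemma le_bnd: "k \<le> bnd k"
  by (induction k) (auto simp: bnd_simps)

text \<open>Losses are counted in units of 1/100 and all quantifiers are bounded, which makes the
  test decidable. The factors 100 and 3 express a mean loss above one third.\<close>

definition certificate :: "nat \<Rightarrow> nat \<Rightarrow> bool list \<Rightarrow> nat \<Rightarrow> bool list \<Rightarrow> bool" where
  "certificate e k z s w \<longleftrightarrow> length w = bnd (Suc k) \<and> take (bnd k) w = z
    \<and> (\<forall>i<blen k. halts s e (take (bnd k + i) w))
    \<and> 100 * blen k < 3 * (\<Sum>i<blen k. if nth_bit w (bnd k + i)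
         then 100 - answer_level s e (take (bnd k + i) w) else answer_level s e (take (bnd k + i) w))"

definition good :: "nat \<Rightarrow> nat \<Rightarrow> bool list \<Rightarrow> nat \<Rightarrow> bool" where
  "good e k z p \<longleftrightarrow> certificate e k z (pfst p) (string_of (psnd p))"

text \<open>Taking the least witness makes the choice canonical: a selection rule, which sees the
  output but not the random source, recomputes the very same word.\<close>

definition found :: "nat \<Rightarrow> nat \<Rightarrow> bool list \<Rightarrow> bool list" where
  "found e k z = string_of (psnd (LEAST p. good e k z p))"

text \<open>The end of the last block before \<open>k\<close> in which program \<open>e\<close> was tried; \<open>e\<close> is tried again
  only after it has been seen to halt on all shorter prefixes of \<open>z\<close>.\<close>

definition watch :: "nat \<Rightarrow> bool list \<Rightarrow> nat \<Rightarrow> nat" where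
  "watch e z n = rec_nat 0 (\<lambda>k r. if task k = e \<and> (\<forall>i<r. halts k e (take i z)) then bnd (Suc k) else r) n"

text \<open>The block number doubles as the stage bound. The test always terminates, and any finite
  collection of halting queries is confirmed from some block on.\<close>

definition tries :: "nat \<Rightarrow> bool list \<Rightarrow> bool" where
  "tries k z \<longleftrightarrow> (\<forall>i<watch (task k) z k. halts k (task k) (take i z))"

lemma watch_0 [simp]: "watch e z 0 = 0"
  by (simp add: watch_def)

lemma watch_Suc: "watch e z (Suc k) = (if task k = e \<and> tries k z then bnd (Suc k) else watch e z k)"
  by (auto simp: watch_def tries_def)

lemma watch_le_bnd: "watch e z k \<le> bnd k"
  using bnd_less_Suc by (induction k) (auto simp: watch_Suc intro: less_imp_le order_trans)

lemma watch_mono: "j \<le> k \<Longrightarrow> watch e z j \<le> watch e z k"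
  by (rule lift_Suc_mono_le)
    (auto simp: watch_Suc intro: order_trans[OF watch_le_bnd] less_imp_le[OF bnd_less_Suc])

lemma watch_cong:
  assumes "take (bnd k) z = take (bnd k) z'" shows "watch e z k = watch e z' k"
  using assms
proof (induction k)
  case (Suc k)
  have "take (bnd k) z = take (bnd k) z'"
    using arg_cong[OF Suc.prems, of "take (bnd k)"] bnd_less_Suc[of k] by (simp add: min_def split: if_splits)
  then have eq: "watch e z k = watch e z' k" by (rule Suc.IH)
  have "take i z = take i z'" if "i \<le> bnd k" for i
    using arg_cong[OF Suc.prems, of "take i"] bnd_less_Suc[of k] that by (simp add: min_def split: if_splits)
  then have "take i z = take i z'" if "i < watch e z' k" for i
    using that watch_le_bnd[of e z' k] by simp
  then have "(\<forall>i<watch e z k. halts k e (take i z)) \<longleftrightarrow> (\<forall>i<watch e z' k. halts k e (take i z'))"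
    by (simp add: eq)
  then show ?case using eq by (simp add: watch_def)
qed simp

lemma tries_cong:
  assumes "take (bnd k) z = take (bnd k) z'" shows "tries k z \<longleftrightarrow> tries k z'"
proof -
  have "take i z = take i z'" if "i \<le> bnd k" for i
    using arg_cong[OF assms, of "take i"] that by (simp add: min_def split: if_splits)
  then have "take i z = take i z'" if "i < watch (task k) z' k" for i
    using that watch_le_bnd[of "task k" z' k] by simp
  then show ?thesis
    by (simp add: tries_def watch_cong[OF assms])
qed

text \<open>Used only in the analysis, since \<open>defined\<close> is not decidable. A program that
  is no longer alive has an undefined point below its watch and can never pass the test in
  \<open>tries\<close> again.\<close>

definition alive :: "nat \<Rightarrow> nat \<Rightarrow> bool list \<Rightarrow> bool" where
  "alive e k z \<longleftrightarrow> (\<forall>i<watch e z k. defined e (take i z))"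

definition hopeless :: "nat \<Rightarrow> nat \<Rightarrow> bool list \<Rightarrow> bool" where
  "hopeless e k z \<longleftrightarrow> task k = e \<and> tries k z \<and> (\<nexists>p. good e k z p)"

lemma alive_if_hopeless: "hopeless e k z \<Longrightarrow> alive e k z"
  unfolding hopeless_def tries_def alive_def defined_def by blast

text \<open>The watch can only move forward, so life is never regained in an extension.\<close>

lemma alive_prefix:
  assumes "alive e (Suc k) z'" "take (bnd k) z' = z" "length z = bnd k"
  shows "alive e k z"
proof -
  have eq: "watch e z k = watch e z' k"
    using assms by (intro watch_cong) auto
  have "defined e (take i z)" if "i < watch e z k" for i
  proof -
    have "i < watch e z' (Suc k)"
      using that watch_mono[of k "Suc k" e z'] by (simp add: eq)
    then have "defined e (take i z')" using assms(1) by (simp add: alive_def)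
    moreover have "take i z = take i z'"
      using that watch_le_bnd[of e z k] by (simp add: assms(2)[symmetric] min_def)
    ultimately show ?thesis by simp
  qed
  then show ?thesis by (simp add: alive_def)
qed

definition loss :: "nat \<Rightarrow> bool list \<Rightarrow> bool \<Rightarrow> nat" where
  "loss e x b = (if b then 100 - forecast_level e x else forecast_level e x)"

lemma certificate_loss:
  assumes "certificate e k z s w"
  shows "100 * blen k < 3 * (\<Sum>i<blen k. loss e (take (bnd k + i) w) (w ! (bnd k + i)))"
proof -
  have "(\<Sum>i<blen k. if nth_bit w (bnd k + i)
         then 100 - answer_level s e (take (bnd k + i) w) else answer_level s e (take (bnd k + i) w))
     = (\<Sum>i<blen k. loss e (take (bnd k + i) w) (w ! (bnd k + i)))"
    using assms answer_level_eq unfolding certificate_def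
    by (intro sum.cong) (auto simp: loss_def nth_bit_def bnd_Suc_eq)
  with assms show ?thesis by (simp add: certificate_def)
qed

lemma halts_uniform:
  fixes n :: nat
  assumes "\<And>i. i < n \<Longrightarrow> defined e (f i)" obtains s where "\<And>i. i < n \<Longrightarrow> halts s e (f i)"
proof -
  obtain t where t: "\<And>i. i < n \<Longrightarrow> halts (t i) e (f i)"
    using assms unfolding defined_def by metis
  show thesis
  proof
    fix i assume i: "i < n"
    then have "t i \<le> Max (t ` {..<n})" by (intro Max_ge) auto
    with t[OF i] show "halts (Max (t ` {..<n})) e (f i)" by (rule halts_mono)
  qed
qed

lemma goodI:
  assumes "length z = bnd k" "length x = blen k"
    and "\<And>i. i < blen k \<Longrightarrow> defined e (z @ take i x)"
    and "100 * blen k < 3 * (\<Sum>i<blen k. loss e (z @ take i x) (x ! i))"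
  shows "\<exists>p. good e k z p"
proof -
  obtain s where s: "\<And>i. i < blen k \<Longrightarrow> halts s e (z @ take i x)"
    using halts_uniform[of "blen k" e "\<lambda>i. z @ take i x"] assms(3) by metis
  have "(\<Sum>i<blen k. if nth_bit (z @ x) (bnd k + i)
         then 100 - answer_level s e (take (bnd k + i) (z @ x)) else answer_level s e (take (bnd k + i) (z @ x)))
     = (\<Sum>i<blen k. loss e (z @ take i x) (x ! i))"
    using assms(1,2) s answer_level_eq
    by (intro sum.cong) (auto simp: loss_def nth_bit_def nth_append)
  then have "certificate e k z s (z @ x)"
    using assms s by (simp add: certificate_def bnd_Suc_eq)
  then have "good e k z (pair s (list_code (z @ x)))"
    by (simp add: good_def)
  then show ?thesis ..
qed

lemma certificate_found:
  assumes "\<exists>p. good e k z p" shows "\<exists>s. certificate e k z s (found e k z)"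
  using LeastI_ex[OF assms] unfolding found_def good_def by blast

lemma length_found: "\<exists>p. good e k z p \<Longrightarrow> length (found e k z) = bnd (Suc k)"
  and take_found: "\<exists>p. good e k z p \<Longrightarrow> take (bnd k) (found e k z) = z"
  using certificate_found unfolding certificate_def by blast+

section \<open>The idealised process and its potential\<close>

context fixes c0 :: nat begin

definition coins :: "nat \<Rightarrow> nat" where
  "coins k = task k + c0"

text \<open>Block \<open>k\<close> consumes a fixed segment of the source, even if its bits are
  thrown away. The segments are thus disjoint, and each is independent of the state reached before
  it.\<close>

definition offs :: "nat \<Rightarrow> nat" where
  "offs n = rec_nat 0 (\<lambda>k r. r + (coins k + blen k)) n"

lemma offs_0 [simp]: "offs 0 = 0" and offs_Suc: "offs (Suc k) = offs k + (coins k + blen k)"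
  by (simp_all add: offs_def)

lemma offs_mono: "j \<le> k \<Longrightarrow> offs j \<le> offs k"
  by (rule lift_Suc_mono_le) (simp_all add: offs_Suc)

definition fresh :: "nat \<Rightarrow> bool list \<Rightarrow> bool list" where
  "fresh k x = take (coins k + blen k) (drop (offs k) x)"

definition reserved :: "nat \<Rightarrow> bool list \<Rightarrow> bool" where
  "reserved k y \<longleftrightarrow> (\<forall>b\<in>set (take (coins k) y). b)"

text \<open>An idealised step that never waits: at a reserved hopeless try it simply continues with
  random bits. The process becomes total, and a block after a hopeless try is exactly uniform. The
  actual operation agrees with it as long as no reserved try is hopeless.\<close>

definition step :: "nat \<Rightarrow> bool list \<Rightarrow> bool list \<Rightarrow> bool list" where
  "step k z y = (if tries k z \<and> reserved k y \<and> (\<exists>p. good (task k) k z p)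
     then found (task k) k z else z @ drop (coins k) y)"

definition state :: "bool list \<Rightarrow> nat \<Rightarrow> bool list" where
  "state x n = rec_nat [] (\<lambda>k z. step k z (fresh k x)) n"

lemma state_0 [simp]: "state x 0 = []" and state_Suc: "state x (Suc k) = step k (state x k) (fresh k x)"
  by (simp_all add: state_def)

lemma length_step:
  assumes "length z = bnd k" "length y = coins k + blen k"
  shows "length (step k z y) = bnd (Suc k)"
  using assms length_found by (simp add: step_def bnd_Suc_eq)

lemma take_step: "length z = bnd k \<Longrightarrow> take (bnd k) (step k z y) = z"
  using take_found by (simp add: step_def)

lemma length_state: "offs k \<le> length x \<Longrightarrow> length (state x k) = bnd k"
proof (induction k)
  case (Suc k)
  then show ?case unfolding state_Suc by (intro length_step) (auto simp: offs_Suc fresh_def)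
qed simp

lemma fresh_append:
  "offs (Suc k) \<le> length x \<Longrightarrow> fresh k (x @ y) = fresh k x"
  by (simp add: fresh_def offs_Suc)

lemma state_append: "offs k \<le> length x \<Longrightarrow> state (x @ y) k = state x k"
proof (induction k)
  case (Suc k)
  then have "offs k \<le> length x" by (simp add: offs_Suc)
  with Suc show ?case by (simp add: state_Suc fresh_append)
qed simp

lemma state_pref: "offs k \<le> n \<Longrightarrow> state (pref \<alpha> n) k = state (pref \<alpha> (offs k)) k"
  using state_append[of k "pref \<alpha> (offs k)" "drop (offs k) (pref \<alpha> n)"]
  by (metis append_take_drop_id length_pref min_def order_refl take_pref)

lemma fresh_pref: "offs (Suc k) \<le> n \<Longrightarrow> fresh k (pref \<alpha> n) = fresh k (pref \<alpha> (offs (Suc k)))"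
  using fresh_append[of k "pref \<alpha> (offs (Suc k))" "drop (offs (Suc k)) (pref \<alpha> n)"]
  by (metis append_take_drop_id length_pref min_def order_refl take_pref)

text \<open>The state before block \<open>k\<close> depends on the first \<open>offs k\<close> bits
  only, and the segment of the block is independent of them.\<close>

lemma avg_step:
  "avg (offs (Suc k)) (\<lambda>x. h (state x k) (fresh k x))
     = avg (offs k) (\<lambda>x. avg (coins k + blen k) (\<lambda>y. h (state x k) y))"
proof -
  have fr: "fresh k (x @ y) = y" if "length x = offs k" "length y = coins k + blen k" for x y
    using that by (simp add: fresh_def)
  show ?thesis
    unfolding offs_Suc avg_append
    by (intro avg_cong) (simp add: state_append fr)
qed

lemma avg_reserved: "avg (coins k + blen k) (\<lambda>y. of_bool (reserved k y)) = (1 / 2) ^ coins k"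
proof -
  have "avg (coins k + blen k) (\<lambda>y. of_bool (reserved k y))
      = avg (coins k) (\<lambda>a. avg (blen k) (\<lambda>b. of_bool (\<forall>b\<in>set a. b)))"
    unfolding avg_append by (intro avg_cong) (simp add: reserved_def)
  also have "\<dots> = (1 / 2) ^ coins k" by (simp add: avg_all)
  finally show ?thesis .
qed

text \<open>The potential, 4 while the program is alive and 0 afterwards, pays 1 for each hopeless
  try. Without a certificate, a uniform block either meets an undefined point or has loss at most
  one third, and the latter has probability at most 3/4; the balance is 1 + 4 * 3/4 = 4.\<close>

lemma alive_step:
  assumes z: "length z = bnd k"
  shows "of_bool (hopeless e k z) + 4 * avg (coins k + blen k) (\<lambda>y. of_bool (alive e (Suc k) (step k z y)))
    \<le> 4 * (of_bool (alive e k z) :: real)"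
proof (cases "hopeless e k z")
  case True
  then have k: "task k = e" "tries k z" and no: "\<nexists>p. good e k z p"
    by (auto simp: hopeless_def)
  have step: "step k z y = z @ drop (coins k) y" for y
    using k no by (simp add: step_def)
  let ?S = "\<lambda>x. \<Sum>i<blen k. if x ! i then 100 - real (forecast_level e (z @ take i x)) else real (forecast_level e (z @ take i x))"
  have bound: "of_bool (alive e (Suc k) (z @ x)) \<le> (of_bool (3 * ?S x \<le> 100 * real (blen k)) :: real)"
    if x: "length x = blen k" for x
  proof (cases "alive e (Suc k) (z @ x)")
    case True
    have "tries k (z @ x)"
      using k(2) tries_cong[of k z "z @ x"] z by simp
    \<comment> \<open>The try moves the watch to the end of this block, so being alive afterwards
      means being defined throughout it.\<close>
    then have "watch e (z @ x) (Suc k) = bnd (Suc k)"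
      by (simp add: watch_Suc k(1))
    then have "defined e (z @ take i x)" if "i < blen k" for i
    proof -
      have "bnd k + i < watch e (z @ x) (Suc k)"
        using that \<open>watch e (z @ x) (Suc k) = bnd (Suc k)\<close> by (simp add: bnd_Suc_eq)
      then have "defined e (take (bnd k + i) (z @ x))" using True by (simp add: alive_def)
      then show ?thesis by (simp add: z)
    qed
    then have "\<not> 100 * blen k < 3 * (\<Sum>i<blen k. loss e (z @ take i x) (x ! i))"
      using goodI[OF z x] no by blast
    then have "3 * real (\<Sum>i<blen k. loss e (z @ take i x) (x ! i)) \<le> 100 * blen k"
      by linarith
    moreover have "real (\<Sum>i<blen k. loss e (z @ take i x) (x ! i)) = ?S x"
      unfolding of_nat_sum by (intro sum.cong) (auto simp: loss_def of_nat_diff forecast_level_le)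
    ultimately show ?thesis by simp
  qed simp
  have "avg (coins k + blen k) (\<lambda>y. of_bool (alive e (Suc k) (step k z y)))
     = avg (coins k) (\<lambda>a. avg (blen k) (\<lambda>b. of_bool (alive e (Suc k) (z @ b))))"
    unfolding avg_append step by (intro avg_cong) simp
  also have "\<dots> = avg (blen k) (\<lambda>b. of_bool (alive e (Suc k) (z @ b)))"
    by simp
  also have "\<dots> \<le> avg (blen k) (\<lambda>x. of_bool (3 * ?S x \<le> 100 * real (blen k)))"
    by (intro avg_mono bound)
  also have "\<dots> \<le> 3 / 4"
    using forecast_level_le
    by (intro avg_loss_small[where h = "\<lambda>x. real (forecast_level e (z @ x))" and m = 100])
      (auto simp: blen_pos)
  finally show ?thesis using True alive_if_hopeless[OF True] by simp
next
  case False
  have "avg (coins k + blen k) (\<lambda>y. of_bool (alive e (Suc k) (step k z y)))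
     \<le> avg (coins k + blen k) (\<lambda>y. of_bool (alive e k z))"
    using alive_prefix[OF _ take_step[OF z] z] by (intro avg_mono) auto
  with False show ?thesis by simp
qed

definition hopeless_at :: "nat \<Rightarrow> nat \<Rightarrow> (nat \<Rightarrow> bool) set" where
  "hopeless_at e k = {\<alpha>. hopeless e k (state (pref \<alpha> (offs k)) k)}"

lemma sets_hopeless_at [measurable]: "hopeless_at e k \<in> sets L"
  unfolding hopeless_at_def by (rule sets_pref)

text \<open>Summing the one-step estimates telescopes the potential, which starts at 4 and stays
  nonnegative.\<close>

lemma sum_hopeless: "(\<Sum>k<n. measure L (hopeless_at e k)) \<le> 4"
proof -
  have "(\<Sum>k<n. measure L (hopeless_at e k)) + 4 * avg (offs n) (\<lambda>x. of_bool (alive e n (state x n))) \<le> 4"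
  proof (induction n)
    case 0
    show ?case by (simp add: alive_def)
  next
    case (Suc k)
    have "measure L (hopeless_at e k) + 4 * avg (offs (Suc k)) (\<lambda>x. of_bool (alive e (Suc k) (state x (Suc k))))
      = avg (offs k) (\<lambda>x. of_bool (hopeless e k (state x k))
          + 4 * avg (coins k + blen k) (\<lambda>y. of_bool (alive e (Suc k) (step k (state x k) y))))"
      unfolding hopeless_at_def avg_add avg_cmult state_Suc measure_pref[of "\<lambda>x. hopeless e k (state x k)"]
      by (subst avg_step[where h = "\<lambda>z y. of_bool (alive e (Suc k) (step k z y))"]) simp
    also have "\<dots> \<le> avg (offs k) (\<lambda>x. 4 * of_bool (alive e k (state x k)))"
      by (intro avg_mono alive_step length_state) simp
    finally show ?case using Suc by (simp add: avg_cmult)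
  qed
  moreover have "0 \<le> avg (offs n) (\<lambda>x. of_bool (alive e n (state x n)))"
    using avg_mono[of "offs n" "\<lambda>_. 0" "\<lambda>x. of_bool (alive e n (state x n))"] by simp
  ultimately show ?thesis by simp
qed

end

section \<open>Almost sure behaviour\<close>

definition tries_at :: "nat \<Rightarrow> nat \<Rightarrow> nat \<Rightarrow> (nat \<Rightarrow> bool) set" where
  "tries_at c0 e k = {\<alpha>. task k = e \<and> tries k (state c0 (pref \<alpha> (offs c0 k)) k)}"

definition reserved_at :: "nat \<Rightarrow> nat \<Rightarrow> (nat \<Rightarrow> bool) set" where
  "reserved_at c0 k = {\<alpha>. reserved c0 k (fresh c0 k (pref \<alpha> (offs c0 (Suc k))))}"

lemma sets_tries_at [measurable]: "tries_at c0 e k \<in> sets L"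
  and sets_reserved_at [measurable]: "reserved_at c0 k \<in> sets L"
  unfolding tries_at_def reserved_at_def by (rule sets_pref)+

lemma offs_le_Suc: "offs c0 k \<le> offs c0 (Suc k)"
  by (simp add: offs_Suc)

text \<open>Whether the try is hopeless is settled before its coins are read, so reserving it is an
  independent event.\<close>

lemma measure_stuck:
  "measure L (hopeless_at c0 e k \<inter> reserved_at c0 k) = (1 / 2) ^ (e + c0) * measure L (hopeless_at c0 e k)"
proof -
  have eq: "hopeless_at c0 e k \<inter> reserved_at c0 k
      = {\<alpha>. hopeless e k (state c0 (pref \<alpha> (offs c0 (Suc k))) k)
          \<and> reserved c0 k (fresh c0 k (pref \<alpha> (offs c0 (Suc k))))}"
    by (auto simp: hopeless_at_def reserved_at_def state_pref[OF offs_le_Suc])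
  have inner: "avg (coins c0 k + blen k) (\<lambda>y. of_bool (hopeless e k z \<and> reserved c0 k y))
      = (1 / 2) ^ (e + c0) * of_bool (hopeless e k z)" for z
  proof (cases "hopeless e k z")
    case True
    then have "coins c0 k = e + c0" by (simp add: hopeless_def coins_def)
    with True show ?thesis using avg_reserved[of c0 k] by simp
  qed simp
  have "measure L (hopeless_at c0 e k \<inter> reserved_at c0 k)
      = avg (offs c0 (Suc k)) (\<lambda>x. of_bool (hopeless e k (state c0 x k) \<and> reserved c0 k (fresh c0 k x)))"
    unfolding eq
    by (rule measure_pref[of "\<lambda>x. hopeless e k (state c0 x k) \<and> reserved c0 k (fresh c0 k x)"])
  also have "\<dots> = avg (offs c0 k) (\<lambda>x. (1 / 2) ^ (e + c0) * of_bool (hopeless e k (state c0 x k)))"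
    unfolding avg_step[where h = "\<lambda>z y. of_bool (hopeless e k z \<and> reserved c0 k y)"] inner ..
  also have "\<dots> = (1 / 2) ^ (e + c0) * measure L (hopeless_at c0 e k)"
    unfolding avg_cmult hopeless_at_def measure_pref[of "\<lambda>x. hopeless e k (state c0 x k)"] ..
  finally show ?thesis .
qed

lemma summable_hopeless: "summable (\<lambda>k. measure L (hopeless_at c0 e k))"
  by (rule summableI_nonneg_bounded[of _ 4]) (simp_all add: sum_hopeless)

lemma measure_stuck_UN:
  "measure L (\<Union>k. hopeless_at c0 e k \<inter> reserved_at c0 k) \<le> 4 * (1 / 2) ^ (e + c0)"
proof -
  have "measure L (\<Union>k. hopeless_at c0 e k \<inter> reserved_at c0 k)
      \<le> (\<Sum>k. measure L (hopeless_at c0 e k \<inter> reserved_at c0 k))"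
    by (rule L.finite_measure_subadditive_countably)
      (auto simp: measure_stuck intro!: summable_mult summable_hopeless)
  also have "\<dots> = (1 / 2) ^ (e + c0) * (\<Sum>k. measure L (hopeless_at c0 e k))"
    unfolding measure_stuck by (rule suminf_mult[OF summable_hopeless])
  also have "\<dots> \<le> (1 / 2) ^ (e + c0) * 4"
    by (intro mult_left_mono suminf_le_const summable_hopeless) (simp_all add: sum_hopeless)
  finally show ?thesis by simp
qed

lemma measure_stuck_all:
  "measure L (\<Union>e. \<Union>k. hopeless_at c0 e k \<inter> reserved_at c0 k) \<le> 8 * (1 / 2) ^ c0"
proof -
  \<comment> \<open>The geometric series over the programs contributes the factor 2, which turns 4
    into 8.\<close>
  have s: "(\<lambda>e. 4 * (1 / 2) ^ (e + c0)) sums (4 * (2 * (1 / 2) ^ c0) :: real)"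
    unfolding power_add using geometric_sums[of "1 / 2 :: real"]
    by (intro sums_mult sums_mult2) simp
  have le: "measure L (\<Union>k. hopeless_at c0 e k \<inter> reserved_at c0 k) \<le> 4 * (1 / 2) ^ (e + c0)" for e
    by (rule measure_stuck_UN)
  have summable: "summable (\<lambda>e. measure L (\<Union>k. hopeless_at c0 e k \<inter> reserved_at c0 k))"
    by (rule summable_comparison_test'[OF sums_summable[OF s], of 0]) (simp only: real_norm_def abs_of_nonneg[OF measure_nonneg] le)
  have "measure L (\<Union>e. \<Union>k. hopeless_at c0 e k \<inter> reserved_at c0 k)
      \<le> (\<Sum>e. measure L (\<Union>k. hopeless_at c0 e k \<inter> reserved_at c0 k))"
    by (rule L.finite_measure_subadditive_countably[OF _ summable]) auto
  also have "\<dots> \<le> (\<Sum>e. 4 * (1 / 2) ^ (e + c0))"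
    by (rule suminf_le[OF le summable sums_summable[OF s]])
  also have "\<dots> = 8 * (1 / 2) ^ c0" using sums_unique[OF s] by simp
  finally show ?thesis .
qed

text \<open>The convergence half of Borel-Cantelli. Hopeless tries that are not reserved count as
  well, because a selection rule cannot see the coins and searches there too.\<close>

lemma AE_finite_hopeless: "AE \<alpha> in L. finite {k. \<alpha> \<in> hopeless_at c0 e k}"
proof -
  have "AE \<alpha> in L. eventually (\<lambda>k. \<alpha> \<in> space L - hopeless_at c0 e k) sequentially"
    by (rule borel_cantelli_AE1) (auto simp: summable_hopeless L.emeasure_finite less_top[symmetric])
  then show ?thesis
  proof (rule AE_mp, intro AE_I2 impI)
    fix \<alpha> assume "eventually (\<lambda>k. \<alpha> \<in> space L - hopeless_at c0 e k) sequentially"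
    then obtain N where "\<And>k. k \<ge> N \<Longrightarrow> \<alpha> \<notin> hopeless_at c0 e k"
      unfolding eventually_sequentially by blast
    then have "{k. \<alpha> \<in> hopeless_at c0 e k} \<subseteq> {..<N}" by (auto simp: not_le[symmetric])
    then show "finite {k. \<alpha> \<in> hopeless_at c0 e k}" by (rule finite_subset) simp
  qed
qed

text \<open>The factors of a martingale that vanishes at the first reserved try of program \<open>e\<close>.\<close>

definition ratio :: "nat \<Rightarrow> nat \<Rightarrow> nat \<Rightarrow> bool list \<Rightarrow> bool list \<Rightarrow> real" where
  "ratio c0 e k z y = (if task k = e \<and> tries k z
     then (if reserved c0 k y then 0 else 1 / (1 - (1 / 2) ^ (e + c0))) else 1)"

lemma half_power_less_1: "0 < c0 \<Longrightarrow> (1 / 2 :: real) ^ (e + c0) < 1"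
  by (intro power_less_one_iff[THEN iffD2]) auto

lemma avg_ratio:
  assumes "0 < c0" shows "avg (coins c0 k + blen k) (ratio c0 e k z) = 1"
proof (cases "task k = e \<and> tries k z")
  case True
  then have c: "coins c0 k = e + c0" by (simp add: coins_def)
  let ?r = "1 / (1 - (1 / 2) ^ (e + c0)) :: real"
  have "avg (coins c0 k + blen k) (ratio c0 e k z)
      = avg (coins c0 k + blen k) (\<lambda>y. ?r + (- ?r) * of_bool (reserved c0 k y))"
    by (intro avg_cong) (simp add: ratio_def True)
  also have "\<dots> = ?r + (- ?r) * (1 / 2) ^ (e + c0)"
    unfolding avg_add avg_cmult avg_reserved by (simp add: c)
  also have "\<dots> = 1"
  proof -
    have "h < 1 \<Longrightarrow> 1 / (1 - h) + (- (1 / (1 - h))) * h = 1" for h :: real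
      by (simp add: field_simps)
    from this[OF half_power_less_1[OF assms]] show ?thesis .
  qed
  finally show ?thesis .
next
  case False
  then have "ratio c0 e k z = (\<lambda>_. 1)" by (auto simp: ratio_def fun_eq_iff)
  then show ?thesis by simp
qed

text \<open>Given the past, the newest factor has mean 1 by \<open>avg_ratio\<close>, so it can be
  integrated out first.\<close>

lemma avg_prod_ratio:
  assumes "0 < c0" "K \<le> k"
  shows "avg (offs c0 k) (\<lambda>x. \<Prod>j\<in>{K..<k}. ratio c0 e j (state c0 x j) (fresh c0 j x)) = 1"
  using assms(2)
proof (induction k rule: dec_induct)
  case base
  show ?case by simp
next
  case (step k)
  let ?P = "\<lambda>x. \<Prod>j\<in>{K..<k}. ratio c0 e j (state c0 x j) (fresh c0 j x)"
  have prefix: "?P (x @ y) = ?P x" if "length x = offs c0 k" for x y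
  proof (rule prod.cong)
    fix j assume "j \<in> {K..<k}"
    then have "offs c0 (Suc j) \<le> length x" "offs c0 j \<le> length x"
      using that offs_mono[of "Suc j" k c0] offs_mono[of j k c0] by auto
    then show "ratio c0 e j (state c0 (x @ y) j) (fresh c0 j (x @ y)) = ratio c0 e j (state c0 x j) (fresh c0 j x)"
      by (simp add: state_append fresh_append)
  qed simp
  have last: "ratio c0 e k (state c0 (x @ y) k) (fresh c0 k (x @ y)) = ratio c0 e k (state c0 x k) y"
    if "length x = offs c0 k" "length y = coins c0 k + blen k" for x y
  proof -
    have "fresh c0 k (x @ y) = y" using that by (simp add: fresh_def)
    then show ?thesis using that by (simp add: state_append)
  qed
  have "avg (offs c0 (Suc k)) (\<lambda>x. \<Prod>j\<in>{K..<Suc k}. ratio c0 e j (state c0 x j) (fresh c0 j x))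
      = avg (offs c0 k) (\<lambda>x. avg (coins c0 k + blen k) (\<lambda>y. ?P x * ratio c0 e k (state c0 x k) y))"
    unfolding offs_Suc avg_append[of "offs c0 k"]
    by (intro avg_cong) (simp only: prod.atLeastLessThan_Suc step.hyps prefix last)
  also have "\<dots> = avg (offs c0 k) ?P"
    unfolding avg_cmult avg_ratio[OF assms(1)] by simp
  finally show ?case using step.IH by simp
qed

text \<open>Markov's inequality for the product of the ratios, whose mean is 1. After
  \<open>m\<close> tries without a reservation the product is at least the \<open>m\<close>-th power
  of the reciprocal of \<open>1 - (1 / 2) ^ (e + c0)\<close>.\<close>

lemma measure_many_unreserved:
  fixes e :: nat
  assumes "0 < c0" "K \<le> k"
  shows "{\<alpha>. m \<le> card {j \<in> {K..<k}. \<alpha> \<in> tries_at c0 e j}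
      \<and> (\<forall>j\<in>{K..<k}. \<alpha> \<in> tries_at c0 e j \<longrightarrow> \<alpha> \<notin> reserved_at c0 j)} \<in> sets L" (is "?E \<in> _")
    "measure L {\<alpha>. m \<le> card {j \<in> {K..<k}. \<alpha> \<in> tries_at c0 e j}
      \<and> (\<forall>j\<in>{K..<k}. \<alpha> \<in> tries_at c0 e j \<longrightarrow> \<alpha> \<notin> reserved_at c0 j)} \<le> (1 - (1 / 2) ^ (e + c0)) ^ m" (is "_ \<le> ?p ^ m")
proof -
  define T where "T x = {j \<in> {K..<k}. task j = e \<and> tries j (state c0 x j)}" for x
  define Q where "Q x \<longleftrightarrow> m \<le> card (T x) \<and> (\<forall>j\<in>T x. \<not> reserved c0 j (fresh c0 j x))" for x
  have p: "0 < ?p" "?p \<le> 1"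
    using half_power_less_1[OF assms(1), of e] by simp_all
  have at: "state c0 (pref \<alpha> (offs c0 k)) j = state c0 (pref \<alpha> (offs c0 j)) j"
     "fresh c0 j (pref \<alpha> (offs c0 k)) = fresh c0 j (pref \<alpha> (offs c0 (Suc j)))" if "j < k" for j \<alpha>
    using that offs_mono[of j k c0] offs_mono[of "Suc j" k c0] by (intro state_pref fresh_pref; simp)+
  have T: "{j \<in> {K..<k}. \<alpha> \<in> tries_at c0 e j} = T (pref \<alpha> (offs c0 k))" for \<alpha>
    using at by (auto simp: T_def tries_at_def)
  have E: "?E = {\<alpha>. Q (pref \<alpha> (offs c0 k))}"
    unfolding T Q_def by (auto simp: T_def tries_at_def reserved_at_def at)
  show "?E \<in> sets L"
    unfolding E by (rule sets_pref)
  from E have "measure L ?E = avg (offs c0 k) (\<lambda>x. of_bool (Q x))"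
    by (simp add: measure_pref)
  also have "\<dots> \<le> avg (offs c0 k) (\<lambda>x. ?p ^ m * (\<Prod>j\<in>{K..<k}. ratio c0 e j (state c0 x j) (fresh c0 j x)))"
  proof (rule avg_mono)
    fix x :: "bool list"
    let ?R = "\<Prod>j\<in>{K..<k}. ratio c0 e j (state c0 x j) (fresh c0 j x)"
    show "of_bool (Q x) \<le> ?p ^ m * ?R"
    proof (cases "Q x")
      case True
      have "?R = (\<Prod>j\<in>T x. 1 / ?p)"
      proof (rule prod.mono_neutral_cong_right)
        show "\<forall>j\<in>{K..<k} - T x. ratio c0 e j (state c0 x j) (fresh c0 j x) = 1"
          by (auto simp: T_def ratio_def)
        show "ratio c0 e j (state c0 x j) (fresh c0 j x) = 1 / ?p" if "j \<in> T x" for j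
          using that True by (auto simp: T_def ratio_def Q_def)
      qed (auto simp: T_def)
      also have "\<dots> = (1 / ?p) ^ card (T x)" by simp
      finally have R: "?R = (1 / ?p) ^ card (T x)" .
      have "?p ^ m * (1 / ?p) ^ m = 1" using p(1) by (simp flip: power_mult_distrib)
      moreover have "(1 / ?p) ^ m \<le> (1 / ?p) ^ card (T x)"
        using True p by (intro power_increasing) (auto simp: Q_def)
      ultimately have "1 \<le> ?p ^ m * (1 / ?p) ^ card (T x)"
        using p(1) by (metis mult_left_mono less_imp_le zero_less_power)
      then show ?thesis using True R by simp
    next
      case False
      have "0 \<le> ?R"
        using p by (intro prod_nonneg) (auto simp: ratio_def)
      with False p show ?thesis by simp
    qed
  qed
  also have "\<dots> = ?p ^ m"
    unfolding avg_cmult avg_prod_ratio[OF assms] by simp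
  finally show "measure L ?E \<le> ?p ^ m" .
qed

lemma measure_UN_incseq_le:
  assumes "\<And>k. A k \<in> sets L" "incseq A" "\<And>k. measure L (A k) \<le> c"
  shows "measure L (\<Union>k. A k) \<le> c"
proof (rule LIMSEQ_le_const2)
  show "(\<lambda>k. measure L (A k)) \<longlonglongrightarrow> measure L (\<Union>k. A k)"
    using assms by (intro L.finite_Lim_measure_incseq) auto
qed (use assms(3) in blast)

text \<open>For a fixed program all tries have the same conditional chance of being reserved. Which
  blocks are tried depends on earlier bits, so the divergence half of Borel-Cantelli for independent
  events does not apply directly; the martingale bound, which tends to 0 with \<open>m\<close>,
  replaces it.\<close>

lemma AE_infinite_reserved:
  assumes "0 < c0"
  shows "AE \<alpha> in L. infinite {k. \<alpha> \<in> tries_at c0 e k} \<longrightarrow> infinite {k. \<alpha> \<in> tries_at c0 e k \<inter> reserved_at c0 k}"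
proof -
  let ?p = "1 - (1 / 2 :: real) ^ (e + c0)"
  define U where "U K = {\<alpha>. infinite {k. \<alpha> \<in> tries_at c0 e k}
      \<and> (\<forall>j\<ge>K. \<alpha> \<in> tries_at c0 e j \<longrightarrow> \<alpha> \<notin> reserved_at c0 j)}" for K
  \<comment> \<open>The second condition ranges over all later blocks, not only those below
    \<open>k\<close>; this makes \<open>V K m\<close> increasing in \<open>k\<close>, and the
    estimate for finitely many blocks still bounds it from above.\<close>
  define V where "V K m k = {\<alpha>. m \<le> card {j \<in> {K..<k}. \<alpha> \<in> tries_at c0 e j}
      \<and> (\<forall>j\<ge>K. \<alpha> \<in> tries_at c0 e j \<longrightarrow> \<alpha> \<notin> reserved_at c0 j)}" for K m k
  have V_sets: "V K m k \<in> sets L" for K m k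
  proof -
    have "V K m k = {\<alpha>. (\<lambda>x. m \<le> card {j \<in> {K..<k}. task j = e \<and> tries j (state c0 (take (offs c0 j) x) j)}) (pref \<alpha> (offs c0 k))}
       \<inter> (\<Inter>j\<in>{K..}. - (tries_at c0 e j \<inter> reserved_at c0 j))"
    proof -
      have "{j \<in> {K..<k}. \<alpha> \<in> tries_at c0 e j}
         = {j \<in> {K..<k}. task j = e \<and> tries j (state c0 (take (offs c0 j) (pref \<alpha> (offs c0 k))) j)}" for \<alpha>
        using offs_mono[of _ k c0] by (auto simp: tries_at_def min_absorb1)
      then show ?thesis by (auto simp: V_def)
    qed
    also have "\<dots> \<in> sets L"
    proof (intro sets.Int sets_pref sets.countable_INT')
      show "(\<lambda>j. - (tries_at c0 e j \<inter> reserved_at c0 j)) ` {K..} \<subseteq> sets L"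
      proof -
        have "- X \<in> sets L" if "X \<in> sets L" for X
          using sets.compl_sets[OF that] by (simp add: Compl_eq_Diff_UNIV)
        then show ?thesis by (intro image_subsetI) simp
      qed
    qed auto
    finally show ?thesis .
  qed
  have V_le: "measure L (\<Union>k. V K m k) \<le> ?p ^ m" for K m
  proof (rule measure_UN_incseq_le[OF V_sets])
    show "incseq (V K m)"
      unfolding incseq_def V_def by (auto elim!: order_trans intro!: card_mono)
    show "measure L (V K m k) \<le> ?p ^ m" for k
    proof (cases "K \<le> k")
      case True
      have "measure L (V K m k) \<le> measure L {\<alpha>. m \<le> card {j \<in> {K..<k}. \<alpha> \<in> tries_at c0 e j}
          \<and> (\<forall>j\<in>{K..<k}. \<alpha> \<in> tries_at c0 e j \<longrightarrow> \<alpha> \<notin> reserved_at c0 j)}"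
        by (rule L.finite_measure_mono[OF _ measure_many_unreserved(1)[OF assms True]]) (auto simp: V_def)
      also have "\<dots> \<le> ?p ^ m" by (rule measure_many_unreserved(2)[OF assms True])
      finally show ?thesis .
    next
      case False
      show ?thesis
      proof (cases m)
        case 0
        then show ?thesis by simp
      next
        case (Suc m')
        with False have "V K m k = {}" by (simp add: V_def)
        then show ?thesis using half_power_less_1[OF assms, of e] by simp
      qed
    qed
  qed
  have null: "(\<Inter>m. \<Union>k. V K m k) \<in> null_sets L" for K
  proof -
    have S: "(\<Inter>m. \<Union>k. V K m k) \<in> sets L"
      using V_sets by (intro sets.countable_INT' sets.countable_UN') auto
    have "measure L (\<Inter>m. \<Union>k. V K m k) \<le> ?p ^ m" for m
    proof -
      have "measure L (\<Inter>m. \<Union>k. V K m k) \<le> measure L (\<Union>k. V K m k)"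
        using V_sets by (intro L.finite_measure_mono sets.countable_UN') auto
      with V_le[of K m] show ?thesis by simp
    qed
    moreover have "(\<lambda>m. ?p ^ m) \<longlonglongrightarrow> 0"
      using half_power_less_1[OF assms, of e] by (intro LIMSEQ_power_zero) simp
    ultimately have "measure L (\<Inter>m. \<Union>k. V K m k) \<le> 0"
      by (intro LIMSEQ_le_const) auto
    then have "measure L (\<Inter>m. \<Union>k. V K m k) = 0"
      using measure_nonneg antisym by blast
    with S show ?thesis by (intro null_setsI) (simp add: L.emeasure_eq_measure)
  qed
  have U: "U K \<subseteq> (\<Inter>m. \<Union>k. V K m k)" for K
  proof safe
    fix \<alpha> m assume \<alpha>: "\<alpha> \<in> U K"
    then have "infinite ({j. \<alpha> \<in> tries_at c0 e j} - {..<K})"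
      by (simp add: U_def)
    then obtain S where S: "finite S" "card S = m" "S \<subseteq> {j. \<alpha> \<in> tries_at c0 e j} - {..<K}"
      using infinite_arbitrarily_large by blast
    define k where "k = Suc (Max (insert 0 S))"
    have "S \<subseteq> {j \<in> {K..<k}. \<alpha> \<in> tries_at c0 e j}"
      using S by (auto simp: k_def less_Suc_eq_le)
    then have "m \<le> card {j \<in> {K..<k}. \<alpha> \<in> tries_at c0 e j}"
      using S(2) card_mono[of "{j \<in> {K..<k}. \<alpha> \<in> tries_at c0 e j}" S] by simp
    with \<alpha> have "\<alpha> \<in> V K m k" by (simp add: U_def V_def)
    then show "\<alpha> \<in> (\<Union>k. V K m k)" by blast
  qed
  have "(\<Union>K. \<Inter>m. \<Union>k. V K m k) \<in> null_sets L"
    using null by (intro null_sets_UN') auto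
  then show ?thesis
  proof (rule AE_I')
    show "{\<alpha> \<in> space L. \<not> (infinite {k. \<alpha> \<in> tries_at c0 e k} \<longrightarrow>
        infinite {k. \<alpha> \<in> tries_at c0 e k \<inter> reserved_at c0 k})} \<subseteq> (\<Union>K. \<Inter>m. \<Union>k. V K m k)"
    proof (rule subsetI)
      fix \<alpha> assume "\<alpha> \<in> {\<alpha> \<in> space L. \<not> (infinite {k. \<alpha> \<in> tries_at c0 e k} \<longrightarrow>
        infinite {k. \<alpha> \<in> tries_at c0 e k \<inter> reserved_at c0 k})}"
      then have "infinite {k. \<alpha> \<in> tries_at c0 e k}" and fin: "finite {k. \<alpha> \<in> tries_at c0 e k \<inter> reserved_at c0 k}"
        by auto
      moreover obtain K where "\<And>k. \<alpha> \<in> tries_at c0 e k \<inter> reserved_at c0 k \<Longrightarrow> k < K"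
        using fin unfolding finite_nat_set_iff_bounded by auto
      ultimately have "\<alpha> \<in> U K" unfolding U_def by (auto simp: not_less[symmetric])
      then show "\<alpha> \<in> (\<Union>K. \<Inter>m. \<Union>k. V K m k)" using U by blast
    qed
  qed
qed

lemma success_set:
  assumes "0 < c0"
  obtains A where "A \<in> sets L" "measure L A \<ge> 1 - 8 * (1 / 2) ^ c0"
    "\<And>\<alpha> e k. \<alpha> \<in> A \<Longrightarrow> \<alpha> \<in> hopeless_at c0 e k \<Longrightarrow> \<alpha> \<notin> reserved_at c0 k"
    "\<And>\<alpha> e. \<alpha> \<in> A \<Longrightarrow> finite {k. \<alpha> \<in> hopeless_at c0 e k}"
    "\<And>\<alpha> e. \<alpha> \<in> A \<Longrightarrow> infinite {k. \<alpha> \<in> tries_at c0 e k}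
       \<Longrightarrow> infinite {k. \<alpha> \<in> tries_at c0 e k \<inter> reserved_at c0 k}"
proof -
  define B where "B = (\<Union>e. \<Union>k. hopeless_at c0 e k \<inter> reserved_at c0 k)"
  have B: "B \<in> sets L" unfolding B_def by auto
  have "AE \<alpha> in L. \<forall>e. finite {k. \<alpha> \<in> hopeless_at c0 e k} \<and> (infinite {k. \<alpha> \<in> tries_at c0 e k}
      \<longrightarrow> infinite {k. \<alpha> \<in> tries_at c0 e k \<inter> reserved_at c0 k})"
    unfolding AE_all_countable using AE_finite_hopeless AE_infinite_reserved[OF assms]
    by (auto intro: AE_conjI)
  then obtain N where N: "N \<in> null_sets L" and ok: "\<And>\<alpha>. \<alpha> \<notin> N \<Longrightarrow> \<forall>e. finite {k. \<alpha> \<in> hopeless_at c0 e k}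
      \<and> (infinite {k. \<alpha> \<in> tries_at c0 e k} \<longrightarrow> infinite {k. \<alpha> \<in> tries_at c0 e k \<inter> reserved_at c0 k})"
    unfolding eventually_ae_filter by auto
  have "measure L (space L - (B \<union> N)) = 1 - measure L (B \<union> N)"
    using B N by (intro L.prob_compl) auto
  also have "measure L (B \<union> N) = measure L B"
    by (rule measure_Un_null_set[OF B N])
  finally have "measure L (space L - (B \<union> N)) \<ge> 1 - 8 * (1 / 2) ^ c0"
    using measure_stuck_all[of c0] by (simp add: B_def)
  moreover have "space L - (B \<union> N) \<in> sets L"
    using B null_setsD2[OF N] by (intro sets.Diff sets.Un sets.top)
  ultimately show thesis
    using that[of "space L - (B \<union> N)"] ok unfolding B_def by blast
qed

section \<open>Computability of the process\<close>

lemma computable_bnd: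
  assumes "computable a" shows "computable (\<lambda>x. bnd (a x))"
  unfolding bnd_def by (intro computable_rec comp_intros assms)

lemma computable_task: "computable a \<Longrightarrow> computable (\<lambda>x. task (a x))"
  unfolding task_def by (rule computable_pfst)

lemma computable_blen: "computable a \<Longrightarrow> computable (\<lambda>x. blen (a x))"
  unfolding blen_def by (intro comp_intros computable_bnd)

lemmas process_intros = comp_intros list_intros computable_bnd computable_task computable_blen
  decidable_halts computable_answer_level

lemma computable_watch:
  assumes "computable e" "computable_list z" "computable n"
  shows "computable (\<lambda>x. watch (e x) (z x) (n x))"
  unfolding watch_def
  by (intro computable_rec process_intros computable_comp[OF assms(1)] computable_comp[OF assms(2)] assms)

lemma decidable_tries:
  assumes "computable k" "computable_list z" shows "decidable (\<lambda>x. tries (k x) (z x))"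
  unfolding tries_def
  by (intro process_intros computable_watch computable_comp[OF assms(1)] computable_comp[OF assms(2)] assms)

lemma decidable_good:
  assumes "computable e" "computable k" "computable_list z" "computable p"
  shows "decidable (\<lambda>x. good (e x) (k x) (z x) (p x))"
  unfolding good_def certificate_def
  by (intro process_intros computable_comp[OF assms(1)] computable_comp[OF assms(2)]
      computable_comp[OF assms(3)] computable_comp[OF assms(4)] assms)

text \<open>Counts the initial numbers up to which \<open>P\<close> has not yet occurred: a
  computable form of \<open>LEAST\<close> once a witness below \<open>n\<close> is known.\<close>

definition least_below :: "nat \<Rightarrow> (nat \<Rightarrow> bool) \<Rightarrow> nat" where
  "least_below n P = (\<Sum>i<n. of_bool (\<forall>j<Suc i. \<not> P j))"

lemma least_below_eq:
  assumes "\<exists>p<n. P p" shows "least_below n P = (LEAST p. P p)"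
proof -
  have P: "P (LEAST p. P p)" "(LEAST p. P p) < n"
    using assms LeastI_ex[of P] Least_le[of P] by (auto intro: le_less_trans)
  have "(\<forall>j<Suc i. \<not> P j) \<longleftrightarrow> i < (LEAST p. P p)" for i
    using P(1) not_less_Least[of _ P] by (metis less_Suc_eq_le not_less order.strict_trans1)
  with P(2) have "{i. i < n \<and> (\<forall>j<Suc i. \<not> P j)} = {..<LEAST p. P p}"
    by auto
  then show ?thesis by (simp add: least_below_def Int_def)
qed

text \<open>The search is cut off at \<open>u\<close> to make the step computable. Where it fails
  for lack of time the result may be wrong; \<open>settled_upto\<close> rules these cases
  out.\<close>

definition step_upto :: "nat \<Rightarrow> nat \<Rightarrow> nat \<Rightarrow> bool list \<Rightarrow> bool list \<Rightarrow> bool list" where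
  "step_upto c0 u k z y = (if tries k z \<and> reserved c0 k y \<and> (\<exists>p<u. good (task k) k z p)
     then string_of (psnd (least_below u (good (task k) k z))) else z @ drop (coins c0 k) y)"

definition state_upto :: "nat \<Rightarrow> nat \<Rightarrow> bool list \<Rightarrow> nat \<Rightarrow> bool list" where
  "state_upto c0 u x n = rec_nat [] (\<lambda>k z. step_upto c0 u k z (fresh c0 k x)) n"

definition settled_upto :: "nat \<Rightarrow> nat \<Rightarrow> bool list \<Rightarrow> nat \<Rightarrow> bool" where
  "settled_upto c0 u x j \<longleftrightarrow> (tries j (state_upto c0 u x j) \<and> reserved c0 j (fresh c0 j x)
     \<longrightarrow> (\<exists>p<u. good (task j) j (state_upto c0 u x j) p))"

text \<open>The existential quantifier over \<open>u\<close> is the waiting: a reserved hopeless try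
  is settled for no \<open>u\<close>, so the output ends before its block.\<close>

definition operation :: "nat \<Rightarrow> (bool list \<times> bool list) set" where
  "operation c0 = {(x, y). \<exists>k u. offs c0 k \<le> length x \<and> (\<forall>j<k. settled_upto c0 u x j)
     \<and> prefix y (state_upto c0 u x k)}"

lemma computable_coins: "computable k \<Longrightarrow> computable (\<lambda>x. coins c0 (k x))"
  unfolding coins_def by (intro process_intros)

lemma computable_offs:
  assumes "computable k" shows "computable (\<lambda>x. offs c0 (k x))"
  unfolding offs_def by (intro computable_rec process_intros computable_coins assms)

lemma computable_fresh:
  assumes "computable k" "computable_list l" shows "computable_list (\<lambda>x. fresh c0 (k x) (l x))"
  unfolding fresh_def by (intro process_intros computable_coins computable_offs assms)

lemma decidable_reserved:
  assumes "computable k" "computable_list l" shows "decidable (\<lambda>x. reserved c0 (k x) (l x))"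
proof -
  have "decidable (\<lambda>x. \<forall>i<coins c0 (k x). i < length (l x) \<longrightarrow> nth_bit (l x) i)"
    by (intro process_intros computable_coins computable_comp[OF assms(1)] computable_comp[OF assms(2)] assms)
  moreover have "(\<forall>i<coins c0 m. i < length y \<longrightarrow> nth_bit y i) \<longleftrightarrow> reserved c0 m y" for m y
    unfolding reserved_def nth_bit_def all_set_conv_all_nth by auto
  ultimately show ?thesis by simp
qed

lemma computable_step_upto:
  assumes "computable u" "computable k" "computable_list z" "computable_list y"
  shows "computable_list (\<lambda>x. step_upto c0 (u x) (k x) (z x) (y x))"
  unfolding step_upto_def least_below_def
  by (intro process_intros decidable_tries decidable_reserved decidable_good computable_coins
      computable_comp[OF assms(1)] computable_comp[OF assms(2)]
      computable_comp[OF assms(3)] computable_comp[OF assms(4)] assms)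

lemma computable_state_upto:
  assumes "computable u" "computable_list l" "computable k"
  shows "computable_list (\<lambda>x. state_upto c0 (u x) (l x) (k x))"
  unfolding state_upto_def
  by (intro computable_list_rec process_intros computable_step_upto computable_fresh
      computable_comp[OF assms(1)] computable_comp[OF assms(2)] assms)

lemma decidable_settled_upto:
  assumes "computable u" "computable_list l" "computable k"
  shows "decidable (\<lambda>x. settled_upto c0 (u x) (l x) (k x))"
  unfolding settled_upto_def
  by (intro process_intros decidable_tries decidable_reserved decidable_good computable_state_upto computable_fresh
      computable_comp[OF assms(1)] computable_comp[OF assms(2)] computable_comp[OF assms(3)] assms)

lemma re_set_operation: "re_set (operation c0)"
proof -
  define D where "D v q \<longleftrightarrow> offs c0 (pfst q) \<le> length (string_of (pfst v))
     \<and> (\<forall>j<pfst q. settled_upto c0 (psnd q) (string_of (pfst v)) j)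
     \<and> prefix (string_of (psnd v)) (state_upto c0 (psnd q) (string_of (pfst v)) (pfst q))" for v q
  have "decidable (\<lambda>v. D (pfst v) (psnd v))"
    unfolding D_def by (intro process_intros computable_offs decidable_settled_upto computable_state_upto)
  then obtain d where d: "\<And>x v. eval d [x] v \<longleftrightarrow> (\<exists>p. D x p) \<and> v = 0"
    using search_program[of D "\<lambda>_. 0", OF _ computable_const] by metis
  have "p \<in> operation c0 \<longleftrightarrow> (\<exists>v. eval d [pair_code p] v)" for p
  proof -
    have "(\<exists>q. D (pair_code p) q) \<longleftrightarrow> (\<exists>k u. D (pair_code p) (pair k u))"
      by (metis pair_pfst_psnd)
    also have "\<dots> \<longleftrightarrow> p \<in> operation c0"
      by (cases p) (simp add: D_def operation_def pair_code_def pair_def[symmetric])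
    finally show ?thesis by (simp add: d)
  qed
  then show ?thesis unfolding re_set_def by blast
qed

lemma step_upto_eq:
  assumes "tries k z \<and> reserved c0 k y \<longrightarrow> (\<exists>p<u. good (task k) k z p)"
  shows "step_upto c0 u k z y = step c0 k z y"
proof (cases "tries k z \<and> reserved c0 k y")
  case True
  with assms have "\<exists>p<u. good (task k) k z p" by blast
  with True least_below_eq[OF this] show ?thesis
    by (auto simp: step_upto_def step_def found_def)
qed (auto simp: step_upto_def step_def)

lemma state_upto_eq:
  "(\<And>j. j < k \<Longrightarrow> settled_upto c0 u x j) \<Longrightarrow> state_upto c0 u x k = state c0 x k"
proof (induction k)
  case (Suc k)
  then have "state_upto c0 u x k = state c0 x k" by simp
  with Suc.prems[of k] step_upto_eq show ?case
    by (simp add: state_upto_def settled_upto_def state_Suc)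
qed (simp add: state_upto_def)

lemma settled_exists:
  assumes "\<And>j. j < k \<Longrightarrow> tries j (state c0 x j) \<Longrightarrow> reserved c0 j (fresh c0 j x)
     \<Longrightarrow> \<exists>p. good (task j) j (state c0 x j) p"
  shows "\<exists>u. \<forall>j<k. settled_upto c0 u x j"
proof -
  obtain p where p: "\<And>j. j < k \<Longrightarrow> tries j (state c0 x j) \<Longrightarrow> reserved c0 j (fresh c0 j x)
     \<Longrightarrow> good (task j) j (state c0 x j) (p j)"
    using assms by metis
  define u where "u = Suc (Max (insert 0 (p ` {..<k})))"
  have u: "p j < u" if "j < k" for j
    using that by (simp add: u_def less_Suc_eq_le)
  \<comment> \<open>Settledness refers to the truncated state, so it is established block by block,
    each time after the truncated state has been identified with the true one.\<close>
  have "j \<le> k \<Longrightarrow> \<forall>i<j. settled_upto c0 u x i" for j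
  proof (induction j)
    case (Suc j)
    then have "state_upto c0 u x j = state c0 x j" by (intro state_upto_eq) simp
    then have "settled_upto c0 u x j"
      using Suc.prems p[of j] u[of j] by (auto simp: settled_upto_def)
    with Suc show ?case by (simp add: less_Suc_eq)
  qed simp
  then show ?thesis by blast
qed

lemma prefix_state:
  assumes "j \<le> k" "offs c0 k \<le> length x" shows "prefix (state c0 x j) (state c0 x k)"
  using assms
proof (induction k rule: dec_induct)
  case (step k)
  then have k: "offs c0 k \<le> length x" by (simp add: offs_Suc)
  have "prefix (state c0 x k) (state c0 x (Suc k))"
    unfolding state_Suc using take_step[OF length_state[OF k]] by (metis take_is_prefix)
  with step.IH[OF k] show ?case by (rule prefix_order.trans)
qed simp

lemma operation_state:
  assumes "(x, y) \<in> operation c0" obtains k where "offs c0 k \<le> length x" "prefix y (state c0 x k)"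
  using assms state_upto_eq unfolding operation_def by auto

text \<open>The true state does not depend on the search bound, so outputs on comparable inputs are
  prefixes of one state of the longer input and hence comparable.\<close>

lemma computable_operation_operation: "computable_operation (operation c0)"
  unfolding computable_operation_def
proof (intro conjI allI impI re_set_operation)
  fix x
  have "offs c0 0 \<le> length x \<and> (\<forall>j<0. settled_upto c0 0 x j) \<and> prefix [] (state_upto c0 0 x 0)"
    by simp
  then show "(x, []) \<in> operation c0" unfolding operation_def by blast
next
  fix x y x' y' assume "(x, y) \<in> operation c0" "(x', y') \<in> operation c0" "prefix x x'"
  then obtain k k' where k: "offs c0 k \<le> length x" "prefix y (state c0 x k)"
     and k': "offs c0 k' \<le> length x'" "prefix y' (state c0 x' k')"
    by (elim operation_state)
  obtain z where x': "x' = x @ z" using \<open>prefix x x'\<close> by (auto simp: prefix_def)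
  have kx: "offs c0 k \<le> length x'" "prefix y (state c0 x' k)"
    using k x' by (simp_all add: state_append)
  have "offs c0 (max k k') \<le> length x'" using kx(1) k'(1) by (simp add: max_def)
  then have "prefix y (state c0 x' (max k k'))" "prefix y' (state c0 x' (max k k'))"
    using kx k' prefix_state[of k "max k k'" c0 x'] prefix_state[of k' "max k k'" c0 x']
    by (auto intro: prefix_order.trans)
  then show "prefix y y' \<or> prefix y' y" by (rule prefix_same_cases)
qed

section \<open>Selection rules as programs\<close>

definition block :: "nat \<Rightarrow> nat" where
  "block n = (\<Sum>k<n. of_bool (bnd (Suc k) \<le> n))"

lemma block_eq:
  assumes "bnd k \<le> n" "n < bnd (Suc k)" shows "block n = k"
proof -
  have "{j. j < n \<and> bnd (Suc j) \<le> n} = {..<k}"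
  proof (intro equalityI subsetI)
    fix j assume "j \<in> {j. j < n \<and> bnd (Suc j) \<le> n}"
    then have "\<not> bnd (Suc k) \<le> bnd (Suc j)" using assms(2) by simp
    then have "\<not> Suc k \<le> Suc j" using bnd_mono by blast
    then show "j \<in> {..<k}" by simp
  next
    fix j assume "j \<in> {..<k}"
    then have "bnd (Suc j) \<le> n" using bnd_mono[of "Suc j" k] assms(1) by simp
    then show "j \<in> {j. j < n \<and> bnd (Suc j) \<le> n}" using le_bnd[of "Suc j"] by simp
  qed
  then show ?thesis by (simp add: block_def Int_def)
qed

definition base :: "bool list \<Rightarrow> bool list" where
  "base x = take (bnd (block (length x))) x"

text \<open>The constant \<open>N\<close> skips the finitely many hopeless tries. It depends on the
  output and need not be computed from it, since for each sequence only the existence of a rule is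
  claimed.\<close>

definition active :: "nat \<Rightarrow> nat \<Rightarrow> bool list \<Rightarrow> bool" where
  "active e N x \<longleftrightarrow> N \<le> block (length x) \<and> task (block (length x)) = e
     \<and> tries (block (length x)) (base x)"

lemma computable_block:
  assumes "computable a" shows "computable (\<lambda>x. block (a x))"
  unfolding block_def by (intro process_intros computable_comp[OF assms] assms)

lemma computable_base:
  assumes "computable_list l" shows "computable_list (\<lambda>x. base (l x))"
  unfolding base_def by (intro process_intros computable_block assms)

lemma decidable_active:
  assumes "computable_list l" shows "decidable (\<lambda>x. active e N (l x))"
  unfolding active_def by (intro process_intros decidable_tries computable_base computable_block assms)

text \<open>A rule may not look at the next output bit, but it can look at the next bit of the word
  found. On a reserved block the two coincide, so the rule selects exactly the positions where the
  output has bit \<open>b\<close>.\<close>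

lemma selection_rule_exists:
  obtains \<delta> where "computable_selection_rule \<delta>"
    "\<And>x. \<not> active e N x \<Longrightarrow> \<delta> x = Some 0"
    "\<And>x w. active e N x \<Longrightarrow> \<exists>p. good e (block (length x)) (base x) p
       \<Longrightarrow> w = found e (block (length x)) (base x)
       \<Longrightarrow> \<delta> x = Some (of_bool (prefix x w \<and> length x < length w \<and> w ! length x = b))"
proof -
  \<comment> \<open>At an inactive string every number is a witness, so the search stops at once and
    \<open>g\<close> returns 0.\<close>
  define D where "D v p \<longleftrightarrow> \<not> active e N (string_of v)
     \<or> good e (block (length (string_of v))) (base (string_of v)) p" for v p
  define g :: "nat \<Rightarrow> nat" where "g q = of_bool (active e N (string_of (pfst q))
      \<and> prefix (string_of (pfst q)) (string_of (psnd (psnd q)))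
      \<and> length (string_of (pfst q)) < length (string_of (psnd (psnd q)))
      \<and> (if b then nth_bit (string_of (psnd (psnd q))) (length (string_of (pfst q)))
         else \<not> nth_bit (string_of (psnd (psnd q))) (length (string_of (pfst q)))))" for q
  have "decidable (\<lambda>v. D (pfst v) (psnd v))"
    unfolding D_def by (intro process_intros decidable_active decidable_good computable_base computable_block)
  moreover have "computable g"
    unfolding g_def by (cases b; simp only: if_True if_False; intro process_intros decidable_active)
  ultimately obtain d where d: "\<And>x v. eval d [x] v \<longleftrightarrow> (\<exists>p. D x p) \<and> v = g (pair x (LEAST p. D x p))"
    by (rule search_program) blast
  define \<delta> where "\<delta> x = (if \<exists>p. D (list_code x) p
     then Some (g (pair (list_code x) (LEAST p. D (list_code x) p))) else None)" for x
  have "g q \<le> 1" for q by (simp add: g_def)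
  then have "computes_selection d \<delta>"
    unfolding computes_selection_def \<delta>_def d by auto
  then have "computable_selection_rule \<delta>"
    unfolding computable_selection_rule_def by blast
  moreover have "\<delta> x = Some 0" if "\<not> active e N x" for x
    using that by (simp add: \<delta>_def D_def g_def)
  moreover have "\<delta> x = Some (of_bool (prefix x w \<and> length x < length w \<and> w ! length x = b))"
    if "active e N x" "\<exists>p. good e (block (length x)) (base x) p" "w = found e (block (length x)) (base x)" for x w
  proof -
    have "D (list_code x) = good e (block (length x)) (base x)"
      using that(1) by (auto simp: D_def)
    then have "\<delta> x = Some (g (pair (list_code x) (LEAST p. good e (block (length x)) (base x) p)))"
      using that(2) by (simp add: \<delta>_def)
    also have "\<dots> = Some (of_bool (prefix x w \<and> length x < length w \<and> w ! length x = b))"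
      using that(1,3) by (auto simp: g_def found_def nth_bit_def)
    finally show ?thesis .
  qed
  ultimately show thesis by (rule that)
qed

section \<open>The selection rules\<close>

lemma block_exists: "\<exists>k. bnd k \<le> n \<and> n < bnd (Suc k)"
proof (induction n)
  case 0
  show ?case using bnd_less_Suc[of 0] by (intro exI[of _ 0]) simp
next
  case (Suc n)
  then obtain k where k: "bnd k \<le> n" "n < bnd (Suc k)" by blast
  show ?case
  proof (cases "Suc n < bnd (Suc k)")
    case True
    with k show ?thesis by (intro exI[of _ k]) simp
  next
    case False
    with k have "Suc n = bnd (Suc k)" by simp
    then show ?thesis using bnd_less_Suc[of "Suc k"] by (intro exI[of _ "Suc k"]) simp
  qed
qed

lemma le_limsup_if_frequently:
  fixes X :: "nat \<Rightarrow> ereal"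
  assumes "\<exists>\<^sub>F n in sequentially. c \<le> X n" shows "c \<le> limsup X"
proof (rule ccontr)
  assume "\<not> c \<le> limsup X"
  then have "eventually (\<lambda>n. X n < c) sequentially" by (intro Limsup_lessD) simp
  with assms show False by (auto simp: frequently_def not_le)
qed

lemma is_prefix_of_if_prefix: "prefix y (pref w n) \<Longrightarrow> is_prefix_of y w"
  unfolding is_prefix_of_def prefix_iff_take
  by (metis length_pref length_take take_pref)

section \<open>The output sequence\<close>

definition stage :: "nat \<Rightarrow> (nat \<Rightarrow> bool) \<Rightarrow> nat \<Rightarrow> bool list" where
  "stage c0 \<alpha> k = state c0 (pref \<alpha> (offs c0 k)) k"

text \<open>Position \<open>i\<close> is already written at stage \<open>Suc i\<close>, because
  \<open>bnd (Suc i)\<close> exceeds \<open>i\<close>. The sequence is that of the idealised process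
  and exists for every \<open>\<alpha>\<close>.\<close>

definition outseq :: "nat \<Rightarrow> (nat \<Rightarrow> bool) \<Rightarrow> nat \<Rightarrow> bool" where
  "outseq c0 \<alpha> i = stage c0 \<alpha> (Suc i) ! i"

lemma length_stage [simp]: "length (stage c0 \<alpha> k) = bnd k"
  by (simp add: stage_def length_state)

lemma state_eq_stage: "offs c0 k \<le> n \<Longrightarrow> state c0 (pref \<alpha> n) k = stage c0 \<alpha> k"
  unfolding stage_def by (rule state_pref)

lemma stage_Suc: "stage c0 \<alpha> (Suc k) = step c0 k (stage c0 \<alpha> k) (fresh c0 k (pref \<alpha> (offs c0 (Suc k))))"
  using state_eq_stage[of c0 k "offs c0 (Suc k)" \<alpha>] by (simp add: stage_def state_Suc offs_Suc)

lemma prefix_stage: "j \<le> k \<Longrightarrow> prefix (stage c0 \<alpha> j) (stage c0 \<alpha> k)"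
  using prefix_state[of j k c0 "pref \<alpha> (offs c0 k)"] offs_mono[of j k c0]
  by (simp add: state_eq_stage)

lemma pref_outseq: "pref (outseq c0 \<alpha>) (bnd k) = stage c0 \<alpha> k"
proof (rule nth_equalityI)
  fix i assume "i < length (pref (outseq c0 \<alpha>) (bnd k))"
  then have i: "i < bnd k" by simp
  have i': "i < bnd (Suc i)" using le_bnd[of "Suc i"] by simp
  have "stage c0 \<alpha> (Suc i) ! i = stage c0 \<alpha> k ! i"
  proof (cases "Suc i \<le> k")
    case True
    from prefix_stage[OF this, of c0 \<alpha>] i' show ?thesis by (auto simp: prefix_def nth_append)
  next
    case False
    then have "k \<le> Suc i" by simp
    from prefix_stage[OF this, of c0 \<alpha>] i show ?thesis by (auto simp: prefix_def nth_append)
  qed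
  with i show "pref (outseq c0 \<alpha>) (bnd k) ! i = stage c0 \<alpha> k ! i" by (simp add: outseq_def)
qed simp

lemma take_stage: "i \<le> bnd k \<Longrightarrow> take i (stage c0 \<alpha> k) = pref (outseq c0 \<alpha>) i"
  by (simp add: pref_outseq[symmetric] min_absorb1)

text \<open>Consistency comes from the agreement with the idealised process. The hypothesis provides
  the length: every wait ends, so a single search bound settles all blocks up to any given
  one.\<close>

lemma op_output_operation:
  assumes "\<And>e k. \<alpha> \<in> hopeless_at c0 e k \<Longrightarrow> \<alpha> \<notin> reserved_at c0 k"
  shows "op_output (operation c0) \<alpha> (outseq c0 \<alpha>)"
  unfolding op_output_def
proof (intro conjI allI impI)
  fix x y assume "is_prefix_of x \<alpha>" "(x, y) \<in> operation c0"
  then obtain k where k: "offs c0 k \<le> length x" "prefix y (state c0 x k)" and x: "x = pref \<alpha> (length x)"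
    by (auto elim: operation_state simp: is_prefix_of_def)
  have "state c0 x k = stage c0 \<alpha> k" using k(1) by (subst x) (simp add: state_eq_stage)
  with k(2) have "prefix y (pref (outseq c0 \<alpha>) (bnd k))" by (simp add: pref_outseq)
  then show "is_prefix_of y (outseq c0 \<alpha>)" by (rule is_prefix_of_if_prefix)
next
  fix n
  let ?x = "pref \<alpha> (offs c0 n)"
  have "\<exists>p. good (task j) j (state c0 ?x j) p"
    if "j < n" "tries j (state c0 ?x j)" "reserved c0 j (fresh c0 j ?x)" for j
  proof -
    have j: "offs c0 j \<le> offs c0 n" "offs c0 (Suc j) \<le> offs c0 n"
      using that(1) by (auto intro: offs_mono)
    have "\<alpha> \<in> reserved_at c0 j"
      using that(3) fresh_pref[OF j(2)] by (simp add: reserved_at_def)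
    then have "\<alpha> \<notin> hopeless_at c0 (task j) j" using assms by blast
    then show ?thesis
      using that(2) by (simp add: hopeless_at_def hopeless_def state_pref[OF j(1)])
  qed
  then obtain u where "\<forall>j<n. settled_upto c0 u ?x j" using settled_exists[of n c0 ?x] by blast
  moreover from this have "state_upto c0 u ?x n = stage c0 \<alpha> n"
    unfolding stage_def by (intro state_upto_eq) simp
  ultimately have "offs c0 n \<le> length ?x \<and> (\<forall>j<n. settled_upto c0 u ?x j)
      \<and> prefix (stage c0 \<alpha> n) (state_upto c0 u ?x n)" by simp
  then have "(?x, stage c0 \<alpha> n) \<in> operation c0"
    unfolding operation_def by blast
  then show "\<exists>x y. is_prefix_of x \<alpha> \<and> (x, y) \<in> operation c0 \<and> n \<le> length y"
    using le_bnd[of n] by (intro exI[of _ ?x] exI[of _ "stage c0 \<alpha> n"]) (simp add: is_prefix_of_def)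
qed

lemma tries_stage: "\<alpha> \<in> tries_at c0 e k \<longleftrightarrow> task k = e \<and> tries k (stage c0 \<alpha> k)"
  by (simp add: tries_at_def stage_def)

lemma hopeless_stage: "\<alpha> \<in> hopeless_at c0 e k \<longleftrightarrow> hopeless e k (stage c0 \<alpha> k)"
  by (simp add: hopeless_at_def stage_def)

text \<open>If the tries stopped, the watch would stay fixed. The finitely many prefixes below it
  are all confirmed at some stage, and a later block of the same program would then be tried after
  all.\<close>

lemma infinite_tries:
  assumes "\<And>n. defined e (pref (outseq c0 \<alpha>) n)"
  shows "infinite {k. \<alpha> \<in> tries_at c0 e k}"
proof
  assume "finite {k. \<alpha> \<in> tries_at c0 e k}"
  then obtain K where K: "\<And>k. \<alpha> \<in> tries_at c0 e k \<Longrightarrow> k < K"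
    unfolding finite_nat_set_iff_bounded by auto
  have watch: "watch e (stage c0 \<alpha> k) k = watch e (stage c0 \<alpha> K) K" if "K \<le> k" for k
    using that
  proof (induction k rule: dec_induct)
    case (step k)
    have take: "take (bnd k) (stage c0 \<alpha> (Suc k)) = take (bnd k) (stage c0 \<alpha> k)"
      by (simp add: take_stage pref_outseq less_imp_le[OF bnd_less_Suc])
    have "\<not> (task k = e \<and> tries k (stage c0 \<alpha> (Suc k)))"
      using K[of k] step.hyps tries_cong[OF take] by (auto simp: tries_stage)
    then have "watch e (stage c0 \<alpha> (Suc k)) (Suc k) = watch e (stage c0 \<alpha> (Suc k)) k"
      by (auto simp: watch_Suc)
    also have "\<dots> = watch e (stage c0 \<alpha> k) k" by (rule watch_cong[OF take])
    finally show ?case using step.IH by simp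
  qed simp
  obtain s where s: "\<And>i. i < watch e (stage c0 \<alpha> K) K \<Longrightarrow> halts s e (pref (outseq c0 \<alpha>) i)"
    using halts_uniform[of "watch e (stage c0 \<alpha> K) K" e "pref (outseq c0 \<alpha>)"] assms by blast
  \<comment> \<open>A block of program \<open>e\<close> with a number at least \<open>K\<close> and
    at least \<open>s\<close>, since the block number is the stage bound of the test.\<close>
  define k where "k = pair e (max K s)"
  have k: "K \<le> k" "s \<le> k" using le_pair(2)[of "max K s" e] by (auto simp: k_def)
  have "task k = e" by (simp add: task_def k_def)
  moreover have "tries k (stage c0 \<alpha> k)"
    unfolding tries_def \<open>task k = e\<close> watch[OF k(1)]
  proof (intro allI impI)
    fix i assume i: "i < watch e (stage c0 \<alpha> K) K"
    then have "i \<le> bnd k"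
      using watch_le_bnd[of e "stage c0 \<alpha> k" k] watch[OF k(1)] by simp
    then show "halts k e (take i (stage c0 \<alpha> k))"
      using halts_mono[OF s[OF i] k(2)] by (simp add: take_stage)
  qed
  ultimately have "\<alpha> \<in> tries_at c0 e k" by (simp add: tries_stage)
  then show False using K k(1) by fastforce
qed

lemma reserved_try:
  assumes "\<alpha> \<notin> hopeless_at c0 e k" "\<alpha> \<in> tries_at c0 e k" "\<alpha> \<in> reserved_at c0 k"
  shows "\<exists>p. good e k (stage c0 \<alpha> k) p" "found e k (stage c0 \<alpha> k) = stage c0 \<alpha> (Suc k)"
    "100 * blen k < 3 * (\<Sum>i\<in>{bnd k..<bnd (Suc k)}. loss e (pref (outseq c0 \<alpha>) i) (outseq c0 \<alpha> i))"
proof -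
  show good: "\<exists>p. good e k (stage c0 \<alpha> k) p"
    using assms by (auto simp: tries_stage hopeless_stage hopeless_def)
  show found: "found e k (stage c0 \<alpha> k) = stage c0 \<alpha> (Suc k)"
    using assms(2,3) good by (auto simp: stage_Suc step_def tries_stage reserved_at_def)
  from certificate_found[OF good] obtain s where "certificate e k (stage c0 \<alpha> k) s (stage c0 \<alpha> (Suc k))"
    unfolding found by blast
  from certificate_loss[OF this]
  have "100 * blen k < 3 * (\<Sum>i<blen k. loss e (pref (outseq c0 \<alpha>) (bnd k + i)) (outseq c0 \<alpha> (bnd k + i)))"
    by (simp add: pref_outseq[symmetric] bnd_Suc_eq)
  also have "(\<Sum>i<blen k. loss e (pref (outseq c0 \<alpha>) (bnd k + i)) (outseq c0 \<alpha> (bnd k + i)))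
      = (\<Sum>i\<in>{bnd k..<bnd (Suc k)}. loss e (pref (outseq c0 \<alpha>) i) (outseq c0 \<alpha> i))"
    by (rule sum.reindex_bij_witness[of _ "\<lambda>i. i - bnd k" "\<lambda>i. bnd k + i"]) (auto simp: bnd_Suc_eq)
  finally show "100 * blen k < 3 * (\<Sum>i\<in>{bnd k..<bnd (Suc k)}. loss e (pref (outseq c0 \<alpha>) i) (outseq c0 \<alpha> i))" .
qed

section \<open>From losses to deviations\<close>

lemma forecast_levels:
  assumes "computes_forecast c f" "f x = Some r"
  shows "defined (rcode c) x" "\<bar>real (forecast_level (rcode c) x) / 100 - r\<bar> \<le> 1 / 50" "0 \<le> r" "r \<le> 1"
proof -
  obtain v where v: "eval c [prod_encode (list_code x, precision)] v"
    using assms unfolding computes_forecast_def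
    by (metis option.distinct(1) rat_decode_precision zero_less_divide_1_iff zero_less_numeral)
  then have d: "derives (rcode c) (query x) v"
    by (simp only: eval_iff_derives query_def pair_def)
  then show "defined (rcode c) x" by (auto simp: defined_iff)
  show r: "0 \<le> r" "r \<le> 1" using assms unfolding computes_forecast_def by blast+
  have "\<bar>rat_decode v - r\<bar> \<le> rat_decode precision"
    using assms v unfolding computes_forecast_def by (metis rat_decode_precision zero_less_divide_1_iff zero_less_numeral)
  then show "\<bar>real (forecast_level (rcode c) x) / 100 - r\<bar> \<le> 1 / 50"
    using level_approx[OF _ r] by (simp add: forecast_level_eq[OF d])
qed

lemma loss_le:
  assumes "\<bar>real (forecast_level e x) / 100 - r\<bar> \<le> 1 / 50" "0 \<le> r" "r \<le> 1"
  shows "real (loss e x b) / 100 - 1 / 50 \<le> \<bar>bit b - r\<bar>"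
proof -
  have "real (forecast_level e x) / 100 - r \<le> 1 / 50" "r - real (forecast_level e x) / 100 \<le> 1 / 50"
    using assms(1) by linarith+
  moreover have loss: "real (loss e x b) = (if b then 100 - real (forecast_level e x) else real (forecast_level e x))"
    using forecast_level_le[of e x] by (simp add: loss_def of_nat_diff)
  moreover have dev: "\<bar>bit b - r\<bar> = (if b then 1 - r else r)"
    using assms(2,3) by (simp add: bit_def)
  ultimately show ?thesis unfolding loss dev by (auto simp: diff_divide_distrib)
qed

text \<open>The earlier blocks fill at most 1/46 of the sequence and can cancel at most that much,
  which leaves (3/20) * (45/46) - 1/46 = 1/8. This equality is the origin of 46.\<close>

lemma deviation_large:
  fixes r :: "nat \<Rightarrow> real" and w :: "nat \<Rightarrow> bool" and v :: "nat \<Rightarrow> nat"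
  assumes k: "46 \<le> Suc k"
    and v: "\<And>i. i < bnd k \<Longrightarrow> v i \<le> 1"
      "\<And>i. i \<in> {bnd k..<bnd (Suc k)} \<Longrightarrow> v i = of_bool (w i = b)"
    and r: "\<And>i. 0 \<le> r i" "\<And>i. r i \<le> 1"
    and large: "3 / 20 * blen k \<le> (\<Sum>i\<in>{bnd k..<bnd (Suc k)}. of_bool (w i = b) * \<bar>bit (w i) - r i\<bar>)"
  shows "1 / 8 \<le> \<bar>1 / bnd (Suc k) * (\<Sum>i<bnd (Suc k). real (v i) * (bit (w i) - r i))\<bar>"
proof -
  let ?S = "\<Sum>i\<in>{bnd k..<bnd (Suc k)}. real (v i) * (bit (w i) - r i)"
  let ?T = "\<Sum>i<bnd k. real (v i) * (bit (w i) - r i)"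
  \<comment> \<open>All selected bits equal \<open>b\<close>, so the selected terms share one sign
    and nothing cancels.\<close>
  have "?S = (if b then 1 else - 1) * (\<Sum>i\<in>{bnd k..<bnd (Suc k)}. of_bool (w i = b) * \<bar>bit (w i) - r i\<bar>)"
    unfolding sum_distrib_left using r by (intro sum.cong) (auto simp: v bit_def)
  then have "\<bar>?S\<bar> = \<bar>\<Sum>i\<in>{bnd k..<bnd (Suc k)}. of_bool (w i = b) * \<bar>bit (w i) - r i\<bar>\<bar>"
    by (simp only: abs_mult) simp
  with large have S: "3 / 20 * blen k \<le> \<bar>?S\<bar>" by linarith
  have "\<bar>?T\<bar> \<le> (\<Sum>i<bnd k. \<bar>real (v i) * (bit (w i) - r i)\<bar>)" by (rule sum_abs)
  also have "\<dots> \<le> (\<Sum>i<bnd k. 1)"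
  proof (rule sum_mono)
    fix i assume "i \<in> {..<bnd k}"
    then have "real (v i) \<le> 1" using v(1) by simp
    moreover have "\<bar>bit (w i) - r i\<bar> \<le> 1" using r[of i] by (simp add: bit_def)
    ultimately show "\<bar>real (v i) * (bit (w i) - r i)\<bar> \<le> 1"
      unfolding abs_mult by (intro mult_le_one) auto
  qed
  finally have T: "\<bar>?T\<bar> \<le> bnd k" by simp
  have sum: "(\<Sum>i<bnd (Suc k). real (v i) * (bit (w i) - r i)) = ?T + ?S"
    using sum.atLeastLessThan_concat[of 0 "bnd k" "bnd (Suc k)" "\<lambda>i. real (v i) * (bit (w i) - r i)"]
      less_imp_le[OF bnd_less_Suc] by (simp add: atLeast0LessThan)
  have "46 * bnd k \<le> Suc k * bnd k" using k by (rule mult_le_mono1)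
  also have "\<dots> \<le> bnd (Suc k)" by (simp add: bnd_simps)
  finally have "46 * bnd k \<le> bnd (Suc k)" .
  moreover have "real (blen k) = real (bnd (Suc k)) - real (bnd k)" by (simp add: bnd_Suc_eq)
  ultimately have "1 / 8 * real (bnd (Suc k)) \<le> \<bar>?T + ?S\<bar>" using S T by linarith
  moreover have "0 < real (bnd (Suc k))" using bnd_less_Suc[of k] by simp
  ultimately show ?thesis unfolding sum abs_mult by (simp add: field_simps)
qed

lemma selection_rule_defeats:
  fixes c0 \<alpha> defines "w \<equiv> outseq c0 \<alpha>"
  assumes stuck: "\<And>e k. \<alpha> \<in> hopeless_at c0 e k \<Longrightarrow> \<alpha> \<notin> reserved_at c0 k"
    and fin: "\<And>e. finite {k. \<alpha> \<in> hopeless_at c0 e k}"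
    and inf: "\<And>e. infinite {k. \<alpha> \<in> tries_at c0 e k} \<Longrightarrow> infinite {k. \<alpha> \<in> tries_at c0 e k \<inter> reserved_at c0 k}"
    and f: "forecasting_algorithm f" "\<And>n. f (pref w n) \<noteq> None"
  shows "\<exists>\<delta>. computable_selection_rule \<delta> \<and> (\<forall>n. \<delta> (pref w n) \<noteq> None) \<and>
    limsup (\<lambda>n. ereal \<bar>(1 / real n) * (\<Sum>i<n.
       real (the (\<delta> (pref w i))) * (bit (w i) - the (f (pref w i))))\<bar>) \<ge> ereal (1/8)"
proof -
  obtain c where c: "computes_forecast c f" using f(1) unfolding forecasting_algorithm_def by blast
  define e where "e = rcode c"
  define r where "r n = the (f (pref w n))" for n
  have "f (pref w n) = Some (r n)" for n using f(2)[of n] by (auto simp: r_def)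
  from forecast_levels[OF c this, folded e_def]
  have def: "defined e (pref w n)" and lev: "\<bar>real (forecast_level e (pref w n)) / 100 - r n\<bar> \<le> 1 / 50"
    and r: "0 \<le> r n" "r n \<le> 1" for n by blast+
  define R where "R = {k. \<alpha> \<in> tries_at c0 e k \<inter> reserved_at c0 k}"
  have "infinite R"
    unfolding R_def by (rule inf, rule infinite_tries) (use def in \<open>simp add: w_def\<close>)
  define D where "D b k = (\<Sum>i\<in>{bnd k..<bnd (Suc k)}. of_bool (w i = b) * \<bar>bit (w i) - r i\<bar>)" for b k
  have large: "\<exists>b. 3 / 20 * blen k \<le> D b k" if "k \<in> R" for k
  proof -
    have "real (100 * blen k) < real (3 * (\<Sum>i\<in>{bnd k..<bnd (Suc k)}. loss e (pref w i) (w i)))"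
      using reserved_try(3)[of \<alpha> c0 e k] stuck[of e k] that unfolding of_nat_less_iff R_def w_def by blast
    then have "100 * real (blen k) < 3 * (\<Sum>i\<in>{bnd k..<bnd (Suc k)}. real (loss e (pref w i) (w i)))"
      by simp
    moreover have "(\<Sum>i\<in>{bnd k..<bnd (Suc k)}. real (loss e (pref w i) (w i)) / 100 - 1 / 50)
        \<le> (\<Sum>i\<in>{bnd k..<bnd (Suc k)}. \<bar>bit (w i) - r i\<bar>)"
      by (intro sum_mono loss_le lev r)
    moreover have "(\<Sum>i\<in>{bnd k..<bnd (Suc k)}. real (loss e (pref w i) (w i)) / 100 - 1 / 50)
      = (\<Sum>i\<in>{bnd k..<bnd (Suc k)}. real (loss e (pref w i) (w i))) / 100 - blen k / 50"
      by (simp add: sum_subtractf sum_divide_distrib bnd_Suc_eq)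
    moreover have "(\<Sum>i\<in>{bnd k..<bnd (Suc k)}. \<bar>bit (w i) - r i\<bar>) = D True k + D False k"
      unfolding D_def sum.distrib[symmetric] by (intro sum.cong) auto
    \<comment> \<open>The loss per position exceeds 1/3 - 1/50 = 47/150, which is more than
      3/10.\<close>
    ultimately have "2 * (3 / 20 * blen k) \<le> D True k + D False k" by linarith
    then have "3 / 20 * blen k \<le> D True k \<or> 3 / 20 * blen k \<le> D False k" by linarith
    then show ?thesis by blast
  qed
  \<comment> \<open>The favourable bit may change from block to block, but one of the two values
    serves infinitely many blocks, and a single rule has to be fixed.\<close>
  have "R = (\<Union>b. {k \<in> R. 3 / 20 * blen k \<le> D b k})" using large by blast
  then have "\<not> (\<forall>b. finite {k \<in> R. 3 / 20 * blen k \<le> D b k})"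
    using \<open>infinite R\<close> finite_UN_I[of UNIV "\<lambda>b. {k \<in> R. 3 / 20 * blen k \<le> D b k}"] by auto
  then obtain b where b: "infinite {k \<in> R. 3 / 20 * blen k \<le> D b k}" by blast
  obtain N where N: "\<And>k. \<alpha> \<in> hopeless_at c0 e k \<Longrightarrow> k < N"
    using fin[of e] unfolding finite_nat_set_iff_bounded by auto
  obtain \<delta> where \<delta>: "computable_selection_rule \<delta>"
    and inactive: "\<And>x. \<not> active e N x \<Longrightarrow> \<delta> x = Some 0"
    and active: "\<And>x u. active e N x \<Longrightarrow> \<exists>p. good e (block (length x)) (base x) p
       \<Longrightarrow> u = found e (block (length x)) (base x)
       \<Longrightarrow> \<delta> x = Some (of_bool (prefix x u \<and> length x < length u \<and> u ! length x = b))"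
    using selection_rule_exists[of e N b] by metis
  have pref: "block (length (pref w n)) = k" "base (pref w n) = stage c0 \<alpha> k"
    if "bnd k \<le> n" "n < bnd (Suc k)" for n k
    using that block_eq[OF that] by (simp_all add: base_def w_def pref_outseq[symmetric] min_absorb1)
  \<comment> \<open>Totality along the output: from block \<open>N\<close> on no try is hopeless, so
    each search that the rule starts comes to an end.\<close>
  have selects: "\<exists>v\<le>1. \<delta> (pref w n) = Some v" for n
  proof (cases "active e N (pref w n)")
    case True
    obtain k where k: "bnd k \<le> n" "n < bnd (Suc k)" using block_exists by blast
    have "task k = e" "tries k (stage c0 \<alpha> k)" "N \<le> k"
      using True unfolding active_def pref[OF k] by auto
    moreover have "\<not> hopeless e k (stage c0 \<alpha> k)"
      using N[of k] \<open>N \<le> k\<close> by (auto simp: hopeless_stage)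
    ultimately have "\<exists>p. good e k (stage c0 \<alpha> k) p" by (auto simp: hopeless_def)
    with active[OF True _ refl] show ?thesis unfolding pref[OF k] by auto
  qed (simp add: inactive)
  \<comment> \<open>On a reserved block the word found is the output itself, so every prefix in the
    block passes the test of the rule.\<close>
  have on_block: "\<delta> (pref w n) = Some (of_bool (w n = b))"
    if k: "k \<in> R" "N \<le> k" and n: "bnd k \<le> n" "n < bnd (Suc k)" for k n
  proof -
    have kR: "\<alpha> \<in> tries_at c0 e k" "\<alpha> \<in> reserved_at c0 k" using k(1) by (auto simp: R_def)
    then have nh: "\<alpha> \<notin> hopeless_at c0 e k" using stuck by blast
    have "active e N (pref w n)"
      using k(2) kR(1) unfolding active_def pref[OF n] by (auto simp: tries_stage)
    from active[OF this, unfolded pref[OF n], OF reserved_try(1)[OF nh kR] refl]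
    show ?thesis
      unfolding reserved_try(2)[OF nh kR] using n
      by (simp add: pref_outseq[symmetric] prefix_iff_take w_def min_absorb1)
  qed
  have "\<exists>\<^sub>F n in sequentially. ereal (1 / 8) \<le> ereal \<bar>(1 / real n) * (\<Sum>i<n.
       real (the (\<delta> (pref w i))) * (bit (w i) - the (f (pref w i))))\<bar>"
    unfolding frequently_sequentially
  proof
    fix m
    have "infinite ({k \<in> R. 3 / 20 * blen k \<le> D b k} - {..<max m (max N 46)})" using b by simp
    then obtain k where "k \<in> {k \<in> R. 3 / 20 * blen k \<le> D b k} - {..<max m (max N 46)}"
      using infinite_imp_nonempty by blast
    then have k: "k \<in> R" "3 / 20 * blen k \<le> D b k" "m \<le> k" "N \<le> k" "46 \<le> k" by auto
    have "1 / 8 \<le> \<bar>1 / bnd (Suc k) * (\<Sum>i<bnd (Suc k). real (the (\<delta> (pref w i))) * (bit (w i) - r i))\<bar>"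
    proof (rule deviation_large[where b = b])
      show "the (\<delta> (pref w i)) \<le> 1" for i using selects[of i] by auto
      show "the (\<delta> (pref w i)) = of_bool (w i = b)" if "i \<in> {bnd k..<bnd (Suc k)}" for i
        using on_block[OF k(1,4)] that by simp
    qed (use k r in \<open>simp_all add: D_def\<close>)
    moreover have "m \<le> bnd (Suc k)" using le_bnd[of "Suc k"] k(3) by simp
    ultimately show "\<exists>n\<ge>m. ereal (1 / 8) \<le> ereal \<bar>(1 / real n) * (\<Sum>i<n.
       real (the (\<delta> (pref w i))) * (bit (w i) - the (f (pref w i))))\<bar>"
      by (intro exI[of _ "bnd (Suc k)"]) (simp add: r_def)
  qed
  from le_limsup_if_frequently[OF this] \<delta> selects show ?thesis
    by (intro exI[of _ \<delta>]) (metis option.distinct(1))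
qed

theorem theorem2:
  fixes \<epsilon> :: real
  assumes "\<epsilon> > 0"
  shows "\<exists>Fh. computable_operation Fh \<and>
    (\<exists>A \<in> sets L. measure L A \<ge> 1 - \<epsilon> \<and>
      (\<forall>\<alpha>\<in>A. \<exists>w. op_output Fh \<alpha> w \<and>
        (\<forall>f. forecasting_algorithm f \<longrightarrow> (\<forall>n. f (pref w n) \<noteq> None) \<longrightarrow>
          (\<exists>\<delta>. computable_selection_rule \<delta> \<and> (\<forall>n. \<delta> (pref w n) \<noteq> None) \<and>
             limsup (\<lambda>n. ereal \<bar>(1 / real n) * (\<Sum>i<n.
                 real (the (\<delta> (pref w i))) * (bit (w i) - the (f (pref w i))))\<bar>)
               \<ge> ereal (1/8)))))"
proof -
  obtain n where n: "(1 / 2 :: real) ^ n < \<epsilon> / 8"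
    using real_arch_pow_inv[of "\<epsilon> / 8" "1 / 2"] assms by auto
  have "0 \<le> (1 / 2 :: real) ^ n" by simp
  with n have "8 * (1 / 2) ^ Suc n \<le> \<epsilon>" unfolding power_Suc by linarith
  \<comment> \<open>The successor makes the number of extra coins positive: otherwise program 0
    would have all its tries reserved, and the factor in the martingale would divide by
    zero.\<close>
  obtain A where A: "A \<in> sets L" "measure L A \<ge> 1 - 8 * (1 / 2) ^ Suc n"
    and stuck: "\<And>\<alpha> e k. \<alpha> \<in> A \<Longrightarrow> \<alpha> \<in> hopeless_at (Suc n) e k \<Longrightarrow> \<alpha> \<notin> reserved_at (Suc n) k"
    and fin: "\<And>\<alpha> e. \<alpha> \<in> A \<Longrightarrow> finite {k. \<alpha> \<in> hopeless_at (Suc n) e k}"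
    and inf: "\<And>\<alpha> e. \<alpha> \<in> A \<Longrightarrow> infinite {k. \<alpha> \<in> tries_at (Suc n) e k}
       \<Longrightarrow> infinite {k. \<alpha> \<in> tries_at (Suc n) e k \<inter> reserved_at (Suc n) k}"
    using success_set[of "Suc n"] by blast
  have "op_output (operation (Suc n)) \<alpha> (outseq (Suc n) \<alpha>)" if "\<alpha> \<in> A" for \<alpha>
    by (rule op_output_operation) (rule stuck[OF that])
  moreover have "\<exists>\<delta>. computable_selection_rule \<delta> \<and> (\<forall>k. \<delta> (pref (outseq (Suc n) \<alpha>) k) \<noteq> None) \<and>
      limsup (\<lambda>k. ereal \<bar>(1 / real k) * (\<Sum>i<k. real (the (\<delta> (pref (outseq (Suc n) \<alpha>) i))) *
         (bit (outseq (Suc n) \<alpha> i) - the (f (pref (outseq (Suc n) \<alpha>) i))))\<bar>) \<ge> ereal (1/8)"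
    if "\<alpha> \<in> A" "forecasting_algorithm f" "\<forall>k. f (pref (outseq (Suc n) \<alpha>) k) \<noteq> None" for \<alpha> f
    using that by (intro selection_rule_defeats stuck[OF that(1)] fin[OF that(1)] inf[OF that(1)]) auto
  moreover have "measure L A \<ge> 1 - \<epsilon>" using A(2) \<open>8 * (1 / 2) ^ Suc n \<le> \<epsilon>\<close> by linarith
  ultimately show ?thesis
    using computable_operation_operation[of "Suc n"] A(1)
    by (intro exI[of _ "operation (Suc n)"] conjI bexI[of _ A] ballI) blast+
qed

end
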